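(* The set of hypercyclic vectors for the operator $D: f\mapsto f'$ of complex differentiation on $H(\mathbb{C})$ is densely strongly algebrable in $H(\mathbb{C})$.
   Context: $H(\mathbb{C})$ is the algebra of entire functions with pointwise product and the compact-open topology. A vector $f$ is hypercyclic for an operator $T$ (continuous linear self-map) on $X$ if $\{f,Tf,T^2f,\dots\}$ is dense in $X$. A subset $Y\subset X$ of a commutative algebra over a field $\mathbb{K}$ is algebraically independent if for any pairwise distinct $y_1,\dots,y_n\in Y$ and any nonzero polynomial $P\in\mathbb{K}[t_1,\dots,t_n]$ with $P(0)=0$ one has $P(y_1,\dots,y_n)\ne0$. The subalgebra generated by $Y$ is $A(Y)=\{P(y_1,\dots,y_n): n\in\mathbb{N},\ y_i\in Y,\ P\in\mathbb{K}[t_1,\dots,t_n],\ P(0)=0\}$ (subalgebras are not required to contain the unit); it is freely generated by $Y$ if $Y$ is algebraically independent. A subset $E$ of a commutative topological algebra $X$ is densely strongly algebrable if $E\cup\{0\}$ contains a dense subalgebra of $X$ freely generated by an infinite set. Here $\mathbb{K}=\mathbb{C}$. *)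

theory Defs
  imports "HOL-Analysis.Analysis" "HOL-Library.Poly_Mapping"
begin

section \<open>The space of entire functions\<close>

definition compact_open_topology ::
    "('a::topological_space \<Rightarrow> 'b::topological_space) topology" where
  "compact_open_topology =
     topology_generated_by
       {{f. continuous_on UNIV f \<and> f ` K \<subseteq> U} | K U. compact K \<and> open U}"

lemma topspace_compact_open_topology:
  "topspace compact_open_topology = {f. continuous_on UNIV f}"
proof -
  have "{f. continuous_on UNIV f} \<in>
      {{f. continuous_on UNIV f \<and> f ` K \<subseteq> U} | (K :: 'a set) (U :: 'b set). compact K \<and> open U}"
    by (rule CollectI, rule exI[of _ "{}"], rule exI[of _ UNIV]) auto
  then show ?thesis
    unfolding compact_open_topology_def topology_generated_by_topspace by blast
qed

definition entire_topology :: "(complex \<Rightarrow> complex) topology" where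
  "entire_topology = subtopology compact_open_topology {f. f holomorphic_on UNIV}"

lemma topspace_entire_topology: "topspace entire_topology = {f. f holomorphic_on UNIV}"
  unfolding entire_topology_def topspace_subtopology topspace_compact_open_topology
  using holomorphic_on_imp_continuous_on by blast


section \<open>Hypercyclic vectors\<close>

text \<open>
  In this section and the next, a topology \<open>X\<close> on a set of complex-valued functions stands for the
  space (or algebra) of functions with carrier \<open>topspace X\<close> and the pointwise operations.
\<close>

definition continuous_operator ::
    "('a \<Rightarrow> complex) topology \<Rightarrow> (('a \<Rightarrow> complex) \<Rightarrow> ('a \<Rightarrow> complex)) \<Rightarrow> bool" where
  "continuous_operator X T \<longleftrightarrow>
     continuous_map X X T \<and>
     (\<forall>f\<in>topspace X. \<forall>g\<in>topspace X. T (\<lambda>z. f z + g z) = (\<lambda>z. T f z + T g z)) \<and>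
     (\<forall>c. \<forall>f\<in>topspace X. T (\<lambda>z. c * f z) = (\<lambda>z. c * T f z))"

definition dense_in :: "'a topology \<Rightarrow> 'a set \<Rightarrow> bool" where
  "dense_in X S \<longleftrightarrow> S \<subseteq> topspace X \<and> X closure_of S = topspace X"

definition hypercyclic ::
    "('a \<Rightarrow> complex) topology \<Rightarrow> (('a \<Rightarrow> complex) \<Rightarrow> ('a \<Rightarrow> complex)) \<Rightarrow> ('a \<Rightarrow> complex) \<Rightarrow> bool" where
  "hypercyclic X T f \<longleftrightarrow>
     continuous_operator X T \<and> f \<in> topspace X \<and> dense_in X {(T ^^ n) f | n. True}"


section \<open>Freely generated subalgebras\<close>

text \<open>
  A polynomial over \<open>\<complex>\<close> in the variables \<open>t\<^sub>0, t\<^sub>1, \<dots>\<close> is a finitely supported map from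
  monomials to coefficients, a monomial being a finitely supported map from variable indices to
  exponents.
\<close>

type_synonym cpoly = "(nat \<Rightarrow>\<^sub>0 nat) \<Rightarrow>\<^sub>0 complex"

definition polys_in :: "nat \<Rightarrow> cpoly set" where
  "polys_in n = {P. \<forall>m\<in>Poly_Mapping.keys P. Poly_Mapping.keys m \<subseteq> {..<n}}"

definition poly_val :: "cpoly \<Rightarrow> (nat \<Rightarrow> complex) \<Rightarrow> complex" where
  "poly_val P x =
     (\<Sum>m\<in>Poly_Mapping.keys P.
        Poly_Mapping.lookup P m * (\<Prod>i\<in>Poly_Mapping.keys m. x i ^ Poly_Mapping.lookup m i))"

text \<open>
  As the algebra operations are pointwise, \<open>P(y\<^sub>0, \<dots>, y\<^sub>n\<^sub>-\<^sub>1)\<close> is computed pointwise.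
\<close>

definition poly_fun :: "cpoly \<Rightarrow> (nat \<Rightarrow> 'a \<Rightarrow> complex) \<Rightarrow> 'a \<Rightarrow> complex" where
  "poly_fun P y = (\<lambda>z. poly_val P (\<lambda>i. y i z))"

definition algebraically_independent :: "('a \<Rightarrow> complex) set \<Rightarrow> bool" where
  "algebraically_independent Y \<longleftrightarrow>
     (\<forall>n y P. inj_on y {..<n} \<and> y ` {..<n} \<subseteq> Y \<and>
        P \<in> polys_in n \<and> P \<noteq> 0 \<and> poly_val P (\<lambda>_. 0) = 0 \<longrightarrow> poly_fun P y \<noteq> (\<lambda>_. 0))"

text \<open>The generated subalgebra need not contain the unit, whence the condition \<open>P(0) = 0\<close>.\<close>

definition generated_subalgebra :: "('a \<Rightarrow> complex) set \<Rightarrow> ('a \<Rightarrow> complex) set" where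
  "generated_subalgebra Y =
     {poly_fun P y | n y P. y ` {..<n} \<subseteq> Y \<and> P \<in> polys_in n \<and> poly_val P (\<lambda>_. 0) = 0}"

definition densely_strongly_algebrable ::
    "('a \<Rightarrow> complex) topology \<Rightarrow> ('a \<Rightarrow> complex) set \<Rightarrow> bool" where
  "densely_strongly_algebrable X E \<longleftrightarrow>
     (\<exists>Y \<subseteq> topspace X. infinite Y \<and> algebraically_independent Y \<and>
        dense_in X (generated_subalgebra Y) \<and>
        generated_subalgebra Y \<subseteq> E \<union> {\<lambda>_. 0})"

end

theory Submission
  imports Defs "HOL-Complex_Analysis.Complex_Analysis"
begin

text \<open>
  The generators are the entries of a sequence \<open>F\<^sub>0, F\<^sub>1, \<dots>\<close> of entire functions that is generic in
  the sense of Baire category. Write \<open>D\<close> for differentiation, and let \<open>Q\<close> be a polynomial without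
  constant term, with leading homogeneous part \<open>Q\<^sub>m\<close> of degree \<open>m \<ge> 1\<close>. Suppose that for some \<open>N\<close> the
  operator \<open>D\<^sup>N\<close> sends every product \<open>F\<^bsub>i(1)\<^esub> \<cdots> F\<^bsub>i(m)\<^esub>\<close> of \<open>m\<close> entries close to the multiple
  \<open>\<kappa>\<^bsub>i(1)\<^esub> \<cdots> \<kappa>\<^bsub>i(m)\<^esub> q\<close> of one function \<open>q\<close>, and every shorter product close to \<open>0\<close>. Then
  \<open>D\<^sup>N (Q(F))\<close> is close to \<open>Q\<^sub>m(\<kappa>) q\<close>, which is a prescribed function \<open>h\<close> as soon as \<open>Q\<^sub>m(\<kappa>) \<noteq> 0\<close> and
  \<open>q = h / Q\<^sub>m(\<kappa>)\<close>. The supposition mentions \<open>m\<close>, the number of variables, the numbers \<open>\<kappa>\<^sub>i\<close>, the function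
  \<open>q\<close> and a tolerance, but not the coefficients of \<open>Q\<close>; since \<open>\<kappa>\<close> and \<open>q\<close> may be drawn from a
  countable dense set, all polynomials \<open>Q\<close> are served by countably many conditions on \<open>F\<close>
  (\<open>hypercyclic_word_combination\<close>).

  Each condition is open by Cauchy's estimates (\<open>tuple_open_derivative_hits\<close>). It is dense
  (\<open>poly_dense_derivative_hits\<close>) because polynomials \<open>p\<^sub>i\<close> can be perturbed to \<open>p\<^sub>i + \<kappa>\<^sub>i R\<close> with one small
  polynomial \<open>R\<close> of huge degree: in a product of at most \<open>m\<close> such factors, every term with fewer than
  \<open>m\<close> factors \<open>R\<close> has degree below \<open>N\<close> and is killed by \<open>D\<^sup>N\<close>, so that everything rests on making
  \<open>D\<^sup>N (R\<^sup>m)\<close> close to \<open>q\<close>. This is achieved in \<open>small_poly_with_prescribed_power_deriv\<close> by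
  \<open>R = c z\<^sup>M (1 + X)\<close> and \<open>N = M m + 1\<close>: the first term of \<open>R\<^sup>m = c\<^sup>m z\<^sup>M\<^sup>m (1 + m X + \<dots>)\<close> is killed, \<open>X\<close> is
  chosen such that the second one is an \<open>N\<close>-th antiderivative of \<open>q\<close>, and the remainder is
  quadratic in \<open>X\<close> and hence negligible.

  A Baire argument (\<open>baire_entire_tuples\<close>) yields a sequence satisfying all conditions, together
  with further ones that make the set of its entries dense. A nonzero polynomial does not vanish
  identically as a function (\<open>monomials_linearly_independent\<close>), so its value at distinct entries is
  hypercyclic and in particular nonzero: the entries are algebraically independent.
\<close>

section \<open>Uniform convergence on discs and the compact-open topology\<close>

lemma higher_deriv_cball_bound:
  assumes f: "f holomorphic_on UNIV" and \<rho>: "0 < \<rho>"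
    and B: "\<And>w. w \<in> cball 0 (r + \<rho>) \<Longrightarrow> norm (f w) \<le> B"
    and z: "z \<in> cball 0 r"
  shows "norm ((deriv ^^ n) f z) \<le> fact n * B / \<rho> ^ n"
proof (rule Cauchy_inequality)
  show "f holomorphic_on ball z \<rho>" "continuous_on (cball z \<rho>) f"
    using f holomorphic_on_subset holomorphic_on_imp_continuous_on by blast+
  show "norm (f x) \<le> B" if "norm (z - x) = \<rho>" for x
  proof (rule B)
    have "norm x \<le> norm z + norm (z - x)"
      by (metis add_diff_cancel_left' diff_add_cancel norm_minus_commute norm_triangle_ineq4 norm_triangle_sub)
    then show "x \<in> cball 0 (r + \<rho>)" using z that by simp
  qed
qed (use \<rho> in auto)

lemma higher_deriv_diff_cball_bound:
  assumes f: "f holomorphic_on UNIV" and g: "g holomorphic_on UNIV" and \<rho>: "0 < \<rho>"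
    and B: "\<And>w. w \<in> cball 0 (r + \<rho>) \<Longrightarrow> norm (f w - g w) \<le> B"
    and z: "z \<in> cball 0 r"
  shows "norm ((deriv ^^ n) f z - (deriv ^^ n) g z) \<le> fact n * B / \<rho> ^ n"
proof -
  have "(deriv ^^ n) f z - (deriv ^^ n) g z = (deriv ^^ n) (\<lambda>w. f w - g w) z"
    using higher_deriv_diff[OF f g] by simp
  then show ?thesis
    using higher_deriv_cball_bound[of "\<lambda>w. f w - g w" \<rho> r B z n] f g \<rho> B z
    by (simp add: holomorphic_on_diff)
qed

lemma generate_compact_open_contains_uniform_ball:
  fixes f :: "complex \<Rightarrow> complex"
  assumes "generate_topology_on
      {{f :: complex \<Rightarrow> complex. continuous_on UNIV f \<and> f ` K \<subseteq> U} | K U. compact K \<and> open U} T"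
    and "f \<in> T"
  shows "\<exists>r e. 0 < e \<and>
    (\<forall>g. continuous_on UNIV g \<longrightarrow> (\<forall>z\<in>cball 0 r. norm (g z - f z) < e) \<longrightarrow> g \<in> T)"
  using assms
proof (induction rule: generate_topology_on.induct)
  case Empty
  then show ?case by simp
next
  case (Int S T)
  then have "f \<in> S" "f \<in> T" by auto
  obtain r e where e: "0 < e" and S: "\<And>g. continuous_on UNIV g \<Longrightarrow>
      \<forall>z\<in>cball 0 r. norm (g z - f z) < e \<Longrightarrow> g \<in> S"
    using Int.IH(1)[OF \<open>f \<in> S\<close>] by blast
  obtain r' e' where e': "0 < e'" and T: "\<And>g. continuous_on UNIV g \<Longrightarrow>
      \<forall>z\<in>cball 0 r'. norm (g z - f z) < e' \<Longrightarrow> g \<in> T"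
    using Int.IH(2)[OF \<open>f \<in> T\<close>] by blast
  show ?case
  proof (rule exI[of _ "max r r'"], rule exI[of _ "min e e'"], intro conjI allI impI)
    fix g :: "complex \<Rightarrow> complex"
    assume "continuous_on UNIV g" "\<forall>z\<in>cball 0 (max r r'). norm (g z - f z) < min e e'"
    then show "g \<in> S \<inter> T" using S T by simp
  qed (use e e' in simp)
next
  case (UN \<K>)
  then show ?case by (meson UnionE UnionI)
next
  case (Basis S)
  then obtain K U where S: "S = {f. continuous_on UNIV f \<and> f ` K \<subseteq> U}" "compact K" "open U"
    by blast
  have cont: "continuous_on UNIV f" and sub: "f ` K \<subseteq> U" using S Basis by auto
  have "compact (f ` K)"
    using S cont compact_continuous_image continuous_on_subset by blast
  then obtain e where e: "0 < e" "(\<Union>x\<in>f ` K. ball x e) \<subseteq> U"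
    using compact_subset_open_imp_ball_epsilon_subset[of "f ` K" U] S sub by blast
  obtain r where r: "K \<subseteq> cball 0 r"
    using bounded_subset_ballD[OF compact_imp_bounded[OF S(2)], of 0] by (meson ball_subset_cball order_trans)
  show ?case
  proof (rule exI[of _ r], rule exI[of _ e], intro conjI allI impI)
    fix g :: "complex \<Rightarrow> complex"
    assume g: "continuous_on UNIV g" and close: "\<forall>z\<in>cball 0 r. norm (g z - f z) < e"
    have "g z \<in> U" if "z \<in> K" for z
    proof -
      have "g z \<in> ball (f z) e" using close r that by (auto simp: dist_norm norm_minus_commute)
      then show ?thesis using e that by blast
    qed
    then show "g \<in> S" using S g by auto
  qed (use e in auto)
qed

text \<open>
  The disc is covered by finitely many small closed discs on each of which \<open>f\<close> varies by less than
  \<open>e / 2\<close>; mapping each of them into a ball of radius \<open>e / 2\<close> is a subbasic condition.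
\<close>
lemma compact_open_nbhd_in_uniform_ball:
  fixes f :: "complex \<Rightarrow> complex"
  assumes f: "continuous_on UNIV f" and e: "0 < e"
  shows "\<exists>T. openin compact_open_topology T \<and> f \<in> T \<and> (\<forall>g\<in>T. \<forall>z\<in>cball 0 r. norm (g z - f z) < e)"
proof -
  have "\<exists>d>0. \<forall>y\<in>cball x d. dist (f x) (f y) < e / 2" for x
  proof -
    obtain d where "d > 0" "\<forall>y. dist y x < d \<longrightarrow> dist (f y) (f x) < e / 2"
      using f e unfolding continuous_on_iff by (metis UNIV_I half_gt_zero)
    then show ?thesis
      by (intro exI[of _ "d / 2"]) (auto simp: dist_commute)
  qed
  then obtain d where d: "\<And>x. d x > 0" "\<And>x y. y \<in> cball x (d x) \<Longrightarrow> dist (f x) (f y) < e / 2"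
    by metis
  have "cball 0 r \<subseteq> (\<Union>x\<in>cball 0 r. ball x (d x))" using d by force
  then obtain C where C: "C \<subseteq> cball 0 r" "finite C" "cball 0 r \<subseteq> (\<Union>x\<in>C. ball x (d x))"
    using compactE_image[of "cball 0 r" "cball 0 r" "\<lambda>x. ball x (d x)"]
    by (metis compact_cball open_ball)
  define S where "S x = {g. continuous_on UNIV g \<and> g ` cball x (d x) \<subseteq> ball (f x) (e / 2)}" for x
  define T where "T = (\<Inter>x\<in>C. S x) \<inter> topspace compact_open_topology"
  have "openin compact_open_topology (S x)" for x
    unfolding compact_open_topology_def S_def
    by (rule topology_generated_by_Basis) (use compact_cball open_ball in blast)
  then have "openin compact_open_topology T"
    unfolding T_def using C by (intro openin_INT) auto
  moreover have "f \<in> T"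
    using d f by (auto simp: T_def S_def topspace_compact_open_topology)
  moreover have "norm (g z - f z) < e" if gz: "g \<in> T" "z \<in> cball 0 r" for g z
  proof -
    obtain x where x: "x \<in> C" "z \<in> ball x (d x)" using C gz by blast
    then have z: "z \<in> cball x (d x)" by simp
    moreover have "g ` cball x (d x) \<subseteq> ball (f x) (e / 2)"
      using gz x by (auto simp: T_def S_def)
    ultimately have "g z \<in> ball (f x) (e / 2)" by blast
    then have "dist (f x) (g z) < e / 2" by simp
    moreover have "dist (f x) (f z) < e / 2" using d z by blast
    ultimately have "dist (g z) (f z) < e"
      by (metis dist_commute dist_triangle_half_r)
    then show ?thesis by (simp add: dist_norm)
  qed
  ultimately show ?thesis by blast
qed

text \<open>
  The compact-open topology on the entire functions is that of uniform convergence on discs. All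
  later estimates are made on discs about the origin, and this is their link to the topology.
\<close>
lemma openin_entire_topology_iff:
  "openin entire_topology W \<longleftrightarrow> W \<subseteq> {f. f holomorphic_on UNIV} \<and>
     (\<forall>f\<in>W. \<exists>r e. 0 < e \<and> (\<forall>g. g holomorphic_on UNIV \<longrightarrow>
        (\<forall>z\<in>cball 0 r. norm (g z - f z) < e) \<longrightarrow> g \<in> W))"
    (is "_ \<longleftrightarrow> ?R")
proof
  assume W: "openin entire_topology W"
  then obtain T where T: "openin compact_open_topology T" "W = T \<inter> {f. f holomorphic_on UNIV}"
    unfolding entire_topology_def openin_subtopology by blast
  have "generate_topology_on
      {{f :: complex \<Rightarrow> complex. continuous_on UNIV f \<and> f ` K \<subseteq> U} | K U. compact K \<and> open U} T"
    using T(1) unfolding compact_open_topology_def by (rule openin_topology_generated_by)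
  note ball = generate_compact_open_contains_uniform_ball[OF this]
  show ?R
  proof (intro conjI ballI)
    fix f assume "f \<in> W"
    then obtain r e where "0 < e" and e: "\<And>g. continuous_on UNIV g \<Longrightarrow>
        (\<forall>z\<in>cball 0 r. norm (g z - f z) < e) \<Longrightarrow> g \<in> T"
      using ball[of f] T(2) by (metis IntD1)
    then show "\<exists>r e. 0 < e \<and> (\<forall>g. g holomorphic_on UNIV \<longrightarrow>
        (\<forall>z\<in>cball 0 r. norm (g z - f z) < e) \<longrightarrow> g \<in> W)"
      unfolding T(2)
      by (intro exI[of _ r] exI[of _ e]) (simp add: holomorphic_on_imp_continuous_on)
  qed (use T(2) in blast)
next
  assume R: ?R
  have "\<exists>T. openin entire_topology T \<and> f \<in> T \<and> T \<subseteq> W" if fW: "f \<in> W" for f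
  proof -
    obtain r e where re: "0 < e" "\<forall>g. g holomorphic_on UNIV \<longrightarrow>
        (\<forall>z\<in>cball 0 r. norm (g z - f z) < e) \<longrightarrow> g \<in> W" using R fW by blast
    have hol: "f holomorphic_on UNIV" using R fW by blast
    obtain T where T: "openin compact_open_topology T" "f \<in> T"
        "\<forall>g\<in>T. \<forall>z\<in>cball 0 r. norm (g z - f z) < e"
      using compact_open_nbhd_in_uniform_ball[of f e r] hol re holomorphic_on_imp_continuous_on by blast
    have "openin entire_topology (T \<inter> {f. f holomorphic_on UNIV})"
      unfolding entire_topology_def using T(1) by (rule openin_subtopology_Int)
    moreover have "T \<inter> {f. f holomorphic_on UNIV} \<subseteq> W"
    proof
      fix g assume "g \<in> T \<inter> {f. f holomorphic_on UNIV}"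
      then show "g \<in> W" using re(2)[rule_format, of g] T(3) by simp
    qed
    ultimately show ?thesis using T(2) hol by blast
  qed
  then show "openin entire_topology W" by (intro openin_subopen[THEN iffD2] ballI)
qed

lemma dense_in_entire_topologyI:
  assumes S: "\<And>f. f \<in> S \<Longrightarrow> f holomorphic_on UNIV"
    and approx: "\<And>h r e. h holomorphic_on UNIV \<Longrightarrow> 0 < e \<Longrightarrow>
      \<exists>f\<in>S. \<forall>z\<in>cball 0 r. norm (f z - h z) < e"
  shows "dense_in entire_topology S"
proof -
  have "h \<in> entire_topology closure_of S" if h: "h holomorphic_on UNIV" for h
    unfolding in_closure_of topspace_entire_topology
  proof (intro conjI allI impI)
    fix T assume T: "h \<in> T \<and> openin entire_topology T"
    then obtain r e where e: "0 < e" and T': "\<And>g. g holomorphic_on UNIV \<Longrightarrow>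
        \<forall>z\<in>cball 0 r. norm (g z - h z) < e \<Longrightarrow> g \<in> T"
      using conjunct2[OF iffD1[OF openin_entire_topology_iff conjunct2[OF T]]] conjunct1[OF T] by blast
    obtain f where "f \<in> S" "\<forall>z\<in>cball 0 r. norm (f z - h z) < e"
      using approx[OF h e] by blast
    then show "\<exists>f. f \<in> S \<and> f \<in> T" using T' S by blast
  qed (use h in simp)
  then show ?thesis
    unfolding dense_in_def using S closure_of_subset_topspace[of entire_topology S]
    by (auto simp: topspace_entire_topology)
qed

lemma continuous_operator_deriv: "continuous_operator entire_topology deriv"
  unfolding continuous_operator_def topspace_entire_topology
proof (intro conjI allI ballI)
  show "continuous_map entire_topology entire_topology deriv"
    unfolding continuous_map topspace_entire_topology
  proof (intro conjI allI impI)
    show "deriv ` {f. f holomorphic_on UNIV} \<subseteq> {f. f holomorphic_on UNIV}"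
      by (auto intro: holomorphic_deriv)
    fix V assume V: "openin entire_topology V"
    show "openin entire_topology {f \<in> {f. f holomorphic_on UNIV}. deriv f \<in> V}"
      unfolding openin_entire_topology_iff
    proof (intro conjI ballI)
      fix f assume f: "f \<in> {f \<in> {f. f holomorphic_on UNIV}. deriv f \<in> V}"
      then obtain r e where re: "0 < e" "\<forall>g. g holomorphic_on UNIV \<longrightarrow>
        (\<forall>z\<in>cball 0 r. norm (g z - deriv f z) < e) \<longrightarrow> g \<in> V"
        using V unfolding openin_entire_topology_iff by (metis (lifting) mem_Collect_eq)
      show "\<exists>r e. 0 < e \<and> (\<forall>g. g holomorphic_on UNIV \<longrightarrow>
          (\<forall>z\<in>cball 0 r. norm (g z - f z) < e) \<longrightarrow>
          g \<in> {f \<in> {f. f holomorphic_on UNIV}. deriv f \<in> V})"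
      proof (rule exI[of _ "r + 1"], rule exI[of _ "e / 2"], intro conjI allI impI)
        fix g assume g: "g holomorphic_on UNIV" "\<forall>z\<in>cball 0 (r + 1). norm (g z - f z) < e / 2"
        have "norm (deriv g z - deriv f z) < e" if "z \<in> cball 0 r" for z
          using higher_deriv_diff_cball_bound[of g f 1 r "e / 2" z 1] g f re that
          by (auto simp: less_imp_le)
        then show "g \<in> {f \<in> {f. f holomorphic_on UNIV}. deriv f \<in> V}"
          using re(2)[rule_format, of "deriv g"] g by (simp add: holomorphic_deriv)
      qed (use re in auto)
    qed auto
  qed
next
  fix f g :: "complex \<Rightarrow> complex"
  assume "f \<in> {f. f holomorphic_on UNIV}" "g \<in> {f. f holomorphic_on UNIV}"
  then show "deriv (\<lambda>z. f z + g z) = (\<lambda>z. deriv f z + deriv g z)"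
    by (intro ext deriv_add) (auto simp: holomorphic_on_imp_differentiable_at)
next
  fix c and f :: "complex \<Rightarrow> complex"
  assume "f \<in> {f. f holomorphic_on UNIV}"
  then show "deriv (\<lambda>z. c * f z) = (\<lambda>z. c * deriv f z)"
    by (intro ext deriv_cmult) (auto simp: holomorphic_on_imp_differentiable_at)
qed

lemma hypercyclic_derivI:
  assumes f: "f holomorphic_on UNIV"
    and approx: "\<And>h r e. h holomorphic_on UNIV \<Longrightarrow> 0 < e \<Longrightarrow>
      \<exists>n. \<forall>z\<in>cball 0 r. norm ((deriv ^^ n) f z - h z) < e"
  shows "hypercyclic entire_topology deriv f"
  unfolding hypercyclic_def
proof (intro conjI)
  show "dense_in entire_topology {(deriv ^^ n) f | n. True}"
    using f approx by (intro dense_in_entire_topologyI) (blast intro: holomorphic_higher_deriv)+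
qed (use f continuous_operator_deriv topspace_entire_topology in auto)

section \<open>A Baire category theorem for sequences of entire functions\<close>

text \<open>
  These are the basic neighbourhoods of \<open>F\<close> for the product topology, in which only finitely many
  entries are constrained. The index \<open>n\<close> bounds both the entries and the radius of the disc.
\<close>
definition tuple_ball :: "(nat \<Rightarrow> complex \<Rightarrow> complex) \<Rightarrow> nat \<Rightarrow> real \<Rightarrow> (nat \<Rightarrow> complex \<Rightarrow> complex) set" where
  "tuple_ball F n \<delta> =
     {G. (\<forall>i. G i holomorphic_on UNIV) \<and> (\<forall>i<n. \<forall>z\<in>cball 0 (real n). norm (G i z - F i z) \<le> \<delta>)}"

lemma tuple_ball_mono:
  assumes "n' \<le> n" "\<delta> \<le> \<delta>'"
  shows "tuple_ball F n \<delta> \<subseteq> tuple_ball F n' \<delta>'"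
proof
  fix G assume G: "G \<in> tuple_ball F n \<delta>"
  have "norm (G i z - F i z) \<le> \<delta>'" if "i < n'" "z \<in> cball 0 (real n')" for i z
  proof -
    have "norm (G i z - F i z) \<le> \<delta>"
      using G that assms(1) by (auto simp: tuple_ball_def)
    then show ?thesis using assms(2) by simp
  qed
  then show "G \<in> tuple_ball F n' \<delta>'" using G by (auto simp: tuple_ball_def)
qed

lemma tuple_ball_triangle:
  assumes "G \<in> tuple_ball F n \<delta>" "H \<in> tuple_ball G n \<delta>'"
  shows "H \<in> tuple_ball F n (\<delta> + \<delta>')"
  unfolding tuple_ball_def
proof (intro CollectI conjI allI impI ballI)
  fix i and z :: complex assume "i < n" "z \<in> cball 0 (real n)"
  then have "norm (G i z - F i z) \<le> \<delta>" "norm (H i z - G i z) \<le> \<delta>'"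
    using assms by (auto simp: tuple_ball_def)
  then show "norm (H i z - F i z) \<le> \<delta> + \<delta>'"
    using norm_triangle_ineq[of "G i z - F i z" "H i z - G i z"] by simp
qed (use assms in \<open>auto simp: tuple_ball_def\<close>)

definition tuple_open :: "(nat \<Rightarrow> complex \<Rightarrow> complex) set \<Rightarrow> bool" where
  "tuple_open U \<longleftrightarrow>
     (\<forall>F\<in>U. (\<forall>i. F i holomorphic_on UNIV) \<longrightarrow> (\<exists>n. \<exists>\<delta>>0. tuple_ball F n \<delta> \<subseteq> U))"

text \<open>
  Density is required only near sequences of polynomials, with a witness that is again a sequence
  of polynomials. This suffices for the Baire argument and keeps degree considerations available
  when density is proved.
\<close>
definition poly_dense :: "(nat \<Rightarrow> complex \<Rightarrow> complex) set \<Rightarrow> bool" where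
  "poly_dense U \<longleftrightarrow>
     (\<forall>p n \<delta>. 0 < \<delta> \<longrightarrow> (\<exists>q. (\<lambda>i. poly (q i)) \<in> U \<inter> tuple_ball (\<lambda>i. poly (p i)) n \<delta>))"

text \<open>
  Nested neighbourhoods centred at sequences of polynomials, each step entering one more of the open
  sets, shrink so fast that their centres converge uniformly on discs; the limit lies in all of them.
\<close>
lemma baire_entire_tuples:
  assumes op: "\<And>s::nat. tuple_open (U s)" and dense: "\<And>s. poly_dense (U s)"
  shows "\<exists>F. (\<forall>i. F i holomorphic_on UNIV) \<and> (\<forall>s. F \<in> U s)"
proof -
  define B where "B = (\<lambda>(p :: nat \<Rightarrow> complex poly, n, \<delta>). tuple_ball (\<lambda>i. poly (p i)) n \<delta>)"
  define good where "good = (\<lambda>s::nat. \<lambda>(p :: nat \<Rightarrow> complex poly, n :: nat, \<delta> :: real). s \<le> n \<and> 0 < \<delta> \<and> \<delta> \<le> (1/2) ^ s)"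
  have step: "\<exists>y. good (Suc s) y \<and> B y \<subseteq> B x \<inter> U s" if "good s x" for s x
  proof -
    obtain p n \<delta> where x: "x = (p, n, \<delta>)" by (cases x) auto
    have n: "s \<le> n" and \<delta>: "0 < \<delta>" "\<delta> \<le> (1/2) ^ s" using that by (auto simp: good_def x)
    obtain q where q: "(\<lambda>i. poly (q i)) \<in> U s" "(\<lambda>i. poly (q i)) \<in> tuple_ball (\<lambda>i. poly (p i)) n (\<delta> / 2)"
      using dense[of s] \<delta> unfolding poly_dense_def by (metis IntD1 IntD2 half_gt_zero)
    have "\<forall>i. poly (q i) holomorphic_on UNIV" using q(2) by (simp add: tuple_ball_def)
    then obtain n' \<delta>' where n': "0 < \<delta>'" "tuple_ball (\<lambda>i. poly (q i)) n' \<delta>' \<subseteq> U s"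
      using bspec[OF op[of s, unfolded tuple_open_def] q(1)] by blast
    define N \<epsilon> where "N = max n' (Suc n)" and "\<epsilon> = min \<delta>' (\<delta> / 2)"
    have "B (q, N, \<epsilon>) \<subseteq> U s"
      using tuple_ball_mono[of n' N \<epsilon> \<delta>' "\<lambda>i. poly (q i)"] n'(2)
      by (auto simp: B_def N_def \<epsilon>_def)
    moreover have "B (q, N, \<epsilon>) \<subseteq> B x"
    proof
      fix H assume "H \<in> B (q, N, \<epsilon>)"
      then have "H \<in> tuple_ball (\<lambda>i. poly (q i)) n (\<delta> / 2)"
        using tuple_ball_mono[of n N \<epsilon> "\<delta> / 2" "\<lambda>i. poly (q i)"]
        unfolding B_def N_def \<epsilon>_def case_prod_conv
        by (meson max.coboundedI2 lessI less_imp_le min.cobounded2 subsetD)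
      from tuple_ball_triangle[OF q(2) this] show "H \<in> B x" by (simp add: B_def x)
    qed
    moreover have "good (Suc s) (q, N, \<epsilon>)"
      using n \<delta> n' by (auto simp: good_def N_def \<epsilon>_def min_le_iff_disj)
    ultimately show ?thesis by blast
  qed
  have "good 0 ((\<lambda>_. 0), 0, 1)" by (simp add: good_def)
  then obtain X where X: "\<And>s. good s (X s)" and nest: "\<And>s. B (X (Suc s)) \<subseteq> B (X s) \<inter> U s"
    using dependent_nat_choice[of good "\<lambda>s x y. B y \<subseteq> B x \<inter> U s"] step by (metis (no_types, lifting))
  define p n \<delta> where "p s = fst (X s)" and "n s = fst (snd (X s))" and "\<delta> s = snd (snd (X s))" for s
  have XE: "X s = (p s, n s, \<delta> s)" for s by (simp add: p_def n_def \<delta>_def)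
  have n: "s \<le> n s" and \<delta>: "0 < \<delta> s" "\<delta> s \<le> (1/2) ^ s" for s
    using X[of s] by (auto simp: good_def XE)
  have sub: "B (X t) \<subseteq> B (X s)" if "s \<le> t" for s t
    using that by (induction rule: dec_induct) (use nest in auto)
  define f where "f = (\<lambda>s i. poly (p s i))"
  have mem: "f t \<in> tuple_ball (f s) (n s) (\<delta> s)" if "s \<le> t" for s t
  proof -
    have "f t \<in> B (X t)"
      using \<delta>[of t] by (auto simp: B_def XE f_def tuple_ball_def intro!: holomorphic_intros)
    then show ?thesis using sub[OF that] by (auto simp: B_def XE f_def)
  qed
  have close: "norm (f t i z - f s i z) \<le> (1/2) ^ s" if "s \<le> t" "i < s" "norm z \<le> real s" for s t i z
  proof -
    have "norm (f t i z - f s i z) \<le> \<delta> s"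
      using mem[OF \<open>s \<le> t\<close>] that n[of s] by (auto simp: tuple_ball_def)
    then show ?thesis using \<delta>(2)[of s] by simp
  qed
  \<comment> \<open>Entry \<open>i\<close> on a given disc is controlled only from the stage on at which \<open>i\<close> and the radius are
    covered by the neighbourhood; before that stage it may change arbitrarily.\<close>
  define F where "F i z = lim (\<lambda>s. f s i z)" for i z
  have cauchy: "uniformly_Cauchy_on (cball 0 (real R)) (\<lambda>s. f s i)" for i R
  proof (rule uniformly_Cauchy_onI)
    fix e :: real assume "e > 0"
    then obtain k where k: "(1/2) ^ k < e / 2"
      using real_arch_pow_inv[of "e / 2" "1/2"] by auto
    define s where "s = Max {k, R, Suc i}"
    have s: "k \<le> s" "R \<le> s" "i < s" by (auto simp: s_def intro!: Max_ge simp: Suc_le_eq[symmetric])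
    have "(1/2) ^ s < e / 2"
      using k power_decreasing[OF s(1), of "1/2::real"] by linarith
    then show "\<exists>M. \<forall>x\<in>cball 0 (real R). \<forall>m\<ge>M. \<forall>n\<ge>M. dist (f m i x) (f n i x) < e"
    proof (intro exI[of _ s] ballI allI impI)
      fix z :: complex and m l assume "z \<in> cball 0 (real R)" "s \<le> m" "s \<le> l"
      moreover from this have "norm z \<le> real s" using s(2) by (simp add: order_trans[of _ "real R"])
      ultimately have "norm (f m i z - f s i z) \<le> (1/2) ^ s" "norm (f l i z - f s i z) \<le> (1/2) ^ s"
        using close s by blast+
      then have "dist (f m i z) (f s i z) < e / 2" "dist (f l i z) (f s i z) < e / 2"
        using \<open>(1/2) ^ s < e / 2\<close> by (auto simp: dist_norm)
      then show "dist (f m i z) (f l i z) < e" by (rule dist_triangle_half_l)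
    qed
  qed
  have lim: "uniform_limit (cball 0 (real R)) (\<lambda>s. f s i) (F i) sequentially" for i R
    using Cauchy_uniformly_convergent[OF cauchy[of R i]]
    unfolding uniformly_convergent_uniform_limit_iff F_def .
  have hol: "F i holomorphic_on UNIV" for i
  proof (rule holomorphic_uniform_sequence)
    show "f s i holomorphic_on UNIV" for s by (auto simp: f_def intro!: holomorphic_intros)
    fix x :: complex
    obtain R where R: "norm x + 1 \<le> real R" using real_arch_simple by blast
    have "cball x 1 \<subseteq> cball 0 (real R)"
      using R by (auto simp: dist_norm) (smt (verit) norm_minus_commute norm_triangle_sub)
    then show "\<exists>d. 0 < d \<and> cball x d \<subseteq> UNIV \<and> uniform_limit (cball x d) (\<lambda>s. f s i) (F i) sequentially"
      using uniform_limit_on_subset[OF lim] by (intro exI[of _ 1]) auto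
  qed auto
  have "F \<in> B (X s)" for s
    unfolding B_def XE tuple_ball_def case_prod_conv
  proof (intro CollectI conjI allI impI hol ballI)
    fix i and z :: complex assume iz: "i < n s" "z \<in> cball 0 (real (n s))"
    have "(\<lambda>t. f t i z) \<longlonglongrightarrow> F i z"
      using tendsto_uniform_limitI[OF lim[of i "n s"]] iz by simp
    then have "(\<lambda>t. norm (f t i z - poly (p s i) z)) \<longlonglongrightarrow> norm (F i z - poly (p s i) z)"
      by (intro tendsto_intros)
    moreover have "\<forall>t\<ge>s. norm (f t i z - poly (p s i) z) \<le> \<delta> s"
      using mem iz by (auto simp: tuple_ball_def f_def)
    ultimately show "norm (F i z - poly (p s i) z) \<le> \<delta> s"
      by (intro LIMSEQ_le_const2) blast+
  qed
  then show ?thesis using hol nest by blast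
qed

section \<open>Small polynomials with a prescribed derivative of a power\<close>

lemma higher_deriv_poly: "(deriv ^^ n) (poly p) = poly ((pderiv ^^ n) p)"
  for p :: "complex poly"
proof (induction n)
  case (Suc n)
  then show ?case by (auto intro!: ext DERIV_imp_deriv poly_DERIV)
qed simp

lemma higher_pderiv_eq_0:
  fixes p :: "complex poly"
  assumes "degree p < n"
  shows "(pderiv ^^ n) p = 0"
  by (rule poly_eqI) (use assms in \<open>simp add: coeff_higher_pderiv coeff_eq_0\<close>)

text \<open>
  The \<open>N\<close>-fold antiderivative of \<open>h\<close> with all integration constants zero is divisible by \<open>z\<^sup>N\<close>; this is
  the quotient.
\<close>
definition antideriv_quotient :: "nat \<Rightarrow> complex poly \<Rightarrow> complex poly" where
  "antideriv_quotient N h = (\<Sum>l\<le>degree h. monom (fact l / fact (N + l) * coeff h l) l)"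

lemma coeff_antideriv_quotient:
  "coeff (antideriv_quotient N h) l = fact l / fact (N + l) * coeff h l"
  by (auto simp: antideriv_quotient_def coeff_sum coeff_eq_0)

lemma degree_antideriv_quotient: "degree (antideriv_quotient N h) \<le> degree h"
  by (rule degree_le) (simp add: coeff_antideriv_quotient coeff_eq_0)

lemma higher_pderiv_antideriv: "(pderiv ^^ N) (monom 1 N * antideriv_quotient N h) = h"
proof (rule poly_eqI)
  fix l
  have "pochhammer 1 (l + N) = pochhammer 1 l * pochhammer (1 + of_nat l) N"
    for N by (simp add: pochhammer_product')
  then have "(fact (N + l) :: complex) = fact l * pochhammer (of_nat (Suc l)) N"
    by (simp add: pochhammer_fact add.commute)
  moreover from this have "pochhammer (of_nat (Suc l)) N \<noteq> (0 :: complex)"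
    by (metis fact_nonzero mult_zero_right)
  ultimately show "coeff ((pderiv ^^ N) (monom 1 N * antideriv_quotient N h)) l = coeff h l"
    by (simp add: coeff_higher_pderiv coeff_monom_mult coeff_antideriv_quotient del: of_nat_Suc)
qed

text \<open>
  After multiplication with \<open>N!\<close> the quotients stay bounded on discs uniformly in \<open>N\<close>, because
  \<open>N! l! / (N + l)! \<le> l!\<close>.
\<close>
lemma norm_antideriv_quotient_le:
  assumes "norm z \<le> \<rho>"
  shows "fact N * norm (poly (antideriv_quotient N h) z)
    \<le> (\<Sum>l\<le>degree h. fact l * norm (coeff h l) * \<rho> ^ l)"
proof -
  have "norm (fact l / fact (N + l) * coeff h l * z ^ l) \<le> fact l * norm (coeff h l) * \<rho> ^ l / fact N"
    for l
  proof -
    have "norm (fact l / fact (N + l) * coeff h l * z ^ l)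
        = fact l * norm (coeff h l) * norm z ^ l / fact (N + l)"
      by (simp add: norm_mult norm_divide norm_power)
    also have "\<dots> \<le> fact l * norm (coeff h l) * \<rho> ^ l / fact N"
      using assms by (intro frac_le mult_left_mono power_mono fact_mono mult_nonneg_nonneg zero_le_power)
        (auto intro: order_trans[OF norm_ge_zero])
    finally show ?thesis .
  qed
  then have "norm (\<Sum>l\<le>degree h. fact l / fact (N + l) * coeff h l * z ^ l)
      \<le> (\<Sum>l\<le>degree h. fact l * norm (coeff h l) * \<rho> ^ l / fact N)"
    by (intro sum_norm_le) simp
  then show ?thesis
    by (simp add: antideriv_quotient_def poly_sum poly_monom sum_divide_distrib[symmetric] field_simps)
qed

lemma norm_power_second_order_le:
  fixes x :: complex
  assumes "norm x \<le> 1"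
  shows "norm ((1 + x) ^ m - 1 - of_nat m * x) \<le> 4 ^ m * norm x ^ 2"
proof (induction m)
  case (Suc m)
  let ?d = "(1 + x) ^ m - 1 - of_nat m * x"
  have "norm (1 + x) \<le> 2" using norm_triangle_ineq[of 1 x] assms by simp
  then have "norm ((1 + x) * ?d) \<le> 2 * (4 ^ m * norm x ^ 2)"
    unfolding norm_mult using Suc by (intro mult_mono) auto
  moreover have "norm (of_nat m * x ^ 2) \<le> 2 * 4 ^ m * norm x ^ 2"
  proof -
    have "real m < 2 ^ m" using of_nat_less_two_power by blast
    also have "\<dots> \<le> (4::real) ^ m" by (intro power_mono) auto
    finally have "real m \<le> 2 * 4 ^ m" by linarith
    then show ?thesis by (simp add: norm_mult norm_power mult_right_mono)
  qed
  moreover have "(1 + x) ^ Suc m - 1 - of_nat (Suc m) * x = (1 + x) * ?d + of_nat m * x ^ 2"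
    by (simp add: algebra_simps power2_eq_square)
  ultimately show ?case
    using norm_triangle_ineq[of "(1 + x) * ?d" "of_nat m * x ^ 2"] by simp
qed simp

lemma poly_higher_deriv_cball_bound:
  fixes p :: "complex poly"
  assumes "0 < \<rho>" "\<And>w. norm w \<le> r + \<rho> \<Longrightarrow> norm (poly p w) \<le> B" "norm z \<le> r"
  shows "norm (poly ((pderiv ^^ n) p) z) \<le> fact n * B / \<rho> ^ n"
  using higher_deriv_cball_bound[of "poly p" \<rho> r B z n] assms
  by (simp add: higher_deriv_poly holomorphic_intros poly_holomorphic_on)

text \<open>
  With \<open>N = M m + 1\<close> and \<open>R = c z\<^sup>M (1 + X)\<close>, the power \<open>R\<^sup>m\<close> equals \<open>c\<^sup>m z\<^sup>N\<^sup>-\<^sup>1 (1 + m X + \<dots>)\<close>. The first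
  term has degree \<open>N - 1\<close> and is killed by the \<open>N\<close>-th derivative; \<open>X\<close> is determined by the requirement that the second
  term be \<open>z\<^sup>N S\<close>, an \<open>N\<close>-th antiderivative of \<open>h\<close>. The choice \<open>c\<^sup>m = 4\<^sup>N / N!\<close> balances two demands. On
  the one hand \<open>N!\<close> in the denominator makes \<open>R\<close> small on every disc. On the other hand \<open>X\<close> is of
  size \<open>4\<^sup>-\<^sup>N\<close>, so the remainder \<open>E\<close>, being quadratic in \<open>X\<close>, gains \<open>4\<^sup>-\<^sup>N\<close> over \<open>z\<^sup>N S\<close>; this outweighs the
  factor \<open>2\<^sup>N\<close> lost in Cauchy's estimate between the discs of radius \<open>\<rho>\<close> and \<open>2\<rho>\<close>. The final
  inequality says that \<open>N\<close> exceeds the degree of every product of fewer than \<open>m\<close> factors \<open>R\<close>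
  with a polynomial of degree at most \<open>L\<close>.
\<close>
lemma small_poly_with_prescribed_power_deriv:
  fixes h :: "complex poly"
  assumes m: "1 \<le> m" and \<eta>: "0 < \<eta>"
  shows "\<exists>R N. (\<forall>z\<in>cball 0 r. norm (poly R z) \<le> \<eta>)
    \<and> (\<forall>z\<in>cball 0 r. norm (poly ((pderiv ^^ N) (R ^ m)) z - poly h z) \<le> \<eta>)
    \<and> (m - 1) * degree R + L < N"
proof -
  define \<rho> where "\<rho> = max r 1"
  have \<rho>: "1 \<le> \<rho>" "r \<le> \<rho>" by (auto simp: \<rho>_def)
  define C where "C = (\<Sum>l\<le>degree h. fact l * norm (coeff h l) * (2 * \<rho>) ^ l)"
  have C: "0 \<le> C" unfolding C_def using \<rho> by (intro sum_nonneg) auto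
  define A where "A = 2 * \<rho> * C"
  have A: "0 \<le> A" using C \<rho> by (simp add: A_def)
  \<comment> \<open>The three limits are used below to bound \<open>X\<close>, the derivative of the remainder, and \<open>R\<^sup>m\<close>.\<close>
  have "(\<lambda>N. A * inverse (4 ^ N)) \<longlonglongrightarrow> A * 0"
    by (intro tendsto_intros LIMSEQ_inverse_realpow_zero) auto
  then have ev1: "eventually (\<lambda>N. A * inverse (4 ^ N) < 1) sequentially"
    by (rule order_tendstoD) simp
  have "(\<lambda>N. 4 ^ m * A\<^sup>2 * inverse (2 ^ N)) \<longlonglongrightarrow> 4 ^ m * A\<^sup>2 * 0"
    by (intro tendsto_intros LIMSEQ_inverse_realpow_zero) auto
  then have ev2: "eventually (\<lambda>N. 4 ^ m * A\<^sup>2 * inverse (2 ^ N) < \<eta>) sequentially"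
    by (rule order_tendstoD) (use \<eta> in simp)
  have "(\<lambda>N. 2 ^ m * (inverse (fact N) * (4 * \<rho>) ^ N)) \<longlonglongrightarrow> 2 ^ m * 0"
    by (intro tendsto_intros summable_LIMSEQ_zero summable_exp)
  then have ev3: "eventually (\<lambda>N. 2 ^ m * (inverse (fact N) * (4 * \<rho>) ^ N) < \<eta> ^ m) sequentially"
    by (rule order_tendstoD) (use \<eta> in simp)
  from ev1 ev2 ev3 have "eventually (\<lambda>N. A * inverse (4 ^ N) < 1 \<and> 4 ^ m * A\<^sup>2 * inverse (2 ^ N) < \<eta>
      \<and> 2 ^ m * (inverse (fact N) * (4 * \<rho>) ^ N) < \<eta> ^ m) sequentially"
    by (simp add: eventually_conj_iff)
  then obtain N0 where N0: "\<And>N. N \<ge> N0 \<Longrightarrow> A * inverse (4 ^ N) < 1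
      \<and> 4 ^ m * A\<^sup>2 * inverse (2 ^ N) < \<eta> \<and> 2 ^ m * (inverse (fact N) * (4 * \<rho>) ^ N) < \<eta> ^ m"
    unfolding eventually_sequentially by blast
  define M where "M = N0 + (m - 1) * (1 + degree h) + L"
  define N where "N = Suc (M * m)"
  have "M \<le> M * m" using m by (cases m) auto
  moreover have "N0 \<le> M" and degM: "(m - 1) * (1 + degree h) + L \<le> M"
    unfolding M_def by linarith+
  ultimately have "N \<ge> N0" unfolding N_def by linarith
  note N0 = N0[OF this]
  define c where "c = root m (4 ^ N / fact N)"
  have c: "0 < c" "c ^ m = 4 ^ N / fact N"
    using m by (auto simp: c_def intro!: real_root_gt_zero real_root_pow_pos2)
  define S where "S = antideriv_quotient N h"
  define X where "X = smult (fact N / (of_nat m * 4 ^ N)) (pCons 0 S)"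
  define R where "R = smult (of_real c) (monom 1 M * (1 + X))"
  have X: "norm (poly X z) \<le> A / 4 ^ N" if z: "norm z \<le> 2 * \<rho>" for z
  proof -
    have "norm (poly X z) = norm z * (fact N * norm (poly S z)) / (real m * 4 ^ N)"
      by (simp add: X_def norm_mult norm_divide norm_power)
    also have "\<dots> \<le> A / (1 * 4 ^ N)"
      unfolding A_def using z norm_antideriv_quotient_le[OF z, of N h] \<rho> C m
      by (intro frac_le mult_mono mult_right_mono) (auto simp: C_def S_def)
    finally show ?thesis by simp
  qed
  have X1: "norm (poly X z) \<le> 1" if "norm z \<le> 2 * \<rho>" for z
    using X[OF that] N0 by (simp add: divide_inverse)
  have cm: "of_real c ^ m = (4 ^ N / fact N :: complex)"
    unfolding of_real_power[symmetric] c(2) by simp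
  have pow: "poly (R ^ m) z = 4 ^ N / fact N * z ^ (M * m) * (1 + poly X z) ^ m" for z
    by (simp add: R_def poly_monom power_mult_distrib power_mult cm)
  define E where "E = R ^ m - monom (4 ^ N / fact N) (M * m) - monom 1 N * S"
  have E: "poly E z = 4 ^ N / fact N * z ^ (M * m) * ((1 + poly X z) ^ m - 1 - of_nat m * poly X z)" for z
  proof -
    have "z ^ N = z * z ^ (M * m)" by (simp add: N_def)
    then have "4 ^ N / fact N * z ^ (M * m) * (of_nat m * poly X z) = z ^ N * poly S z"
      using m by (simp add: X_def)
    then show ?thesis
      unfolding E_def poly_diff pow by (simp add: poly_monom right_diff_distrib)
  qed
  have Ebound: "norm (poly E z) \<le> (8 * \<rho>) ^ N / fact N * (4 ^ m * (A / 4 ^ N)\<^sup>2)"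
    if z: "norm z \<le> 2 * \<rho>" for z
  proof -
    have "norm (z ^ (M * m)) \<le> (2 * \<rho>) ^ (M * m)"
      unfolding norm_power using z by (intro power_mono) auto
    also have "\<dots> \<le> (2 * \<rho>) ^ N" using \<rho> by (intro power_increasing) (auto simp: N_def)
    finally have 1: "norm (4 ^ N / fact N * z ^ (M * m)) \<le> 4 ^ N / fact N * (2 * \<rho>) ^ N"
      by (simp add: norm_mult norm_divide norm_power divide_right_mono)
    have "norm ((1 + poly X z) ^ m - 1 - of_nat m * poly X z) \<le> 4 ^ m * norm (poly X z) ^ 2"
      using X1[OF z] by (rule norm_power_second_order_le)
    also have "\<dots> \<le> 4 ^ m * (A / 4 ^ N)\<^sup>2"
      using X[OF z] by (intro mult_left_mono power_mono) auto
    finally have "norm (poly E z) \<le> 4 ^ N / fact N * (2 * \<rho>) ^ N * (4 ^ m * (A / 4 ^ N)\<^sup>2)"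
      unfolding E norm_mult[of "4 ^ N / fact N * z ^ (M * m)"] using 1 \<rho> by (intro mult_mono) auto
    moreover have "4 ^ N * (2 * \<rho>) ^ N = (8 * \<rho>) ^ N"
      unfolding power_mult_distrib[symmetric] by simp
    ultimately show ?thesis by (simp only: times_divide_eq_left)
  qed
  have close: "norm (poly ((pderiv ^^ N) (R ^ m)) z - poly h z) \<le> \<eta>" if "z \<in> cball 0 r" for z
  proof -
    have "R ^ m = E + monom (4 ^ N / fact N) (M * m) + monom 1 N * S"
      by (simp add: E_def)
    then have "(pderiv ^^ N) (R ^ m) = (pderiv ^^ N) E + h"
      using higher_pderiv_eq_0[of "monom (4 ^ N / fact N) (M * m)" N] degree_monom_le[of "4 ^ N / fact N :: complex" "M * m"]
      by (simp add: higher_pderiv_add S_def higher_pderiv_antideriv N_def del: funpow.simps)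
    then have "norm (poly ((pderiv ^^ N) (R ^ m)) z - poly h z) = norm (poly ((pderiv ^^ N) E) z)"
      by simp
    also have "\<dots> \<le> fact N * ((8 * \<rho>) ^ N / fact N * (4 ^ m * (A / 4 ^ N)\<^sup>2)) / \<rho> ^ N"
      using Ebound \<rho> that by (intro poly_higher_deriv_cball_bound[where r = \<rho>]) auto
    also have "\<dots> = 4 ^ m * A\<^sup>2 * inverse (2 ^ N)"
    proof -
      have "(4 ^ N)\<^sup>2 = (8::real) ^ N * 2 ^ N"
        unfolding power2_eq_square power_mult_distrib[symmetric] by simp
      then have 1: "(A / 4 ^ N)\<^sup>2 = A\<^sup>2 / (8 ^ N * 2 ^ N)" by (simp only: power_divide)
      show ?thesis
        unfolding 1 power_mult_distrib[of 8 \<rho>] using \<rho> by (simp add: divide_simps)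
    qed
    finally show ?thesis using N0 by linarith
  qed
  have small: "norm (poly R z) \<le> \<eta>" if "z \<in> cball 0 r" for z
  proof -
    have z: "norm z \<le> \<rho>" "norm z \<le> 2 * \<rho>" using that \<rho> by auto
    have "norm (1 + poly X z) \<le> 2"
      using norm_triangle_ineq[of 1 "poly X z"] X1[OF z(2)] by simp
    then have "norm (1 + poly X z) ^ m \<le> 2 ^ m" by (intro power_mono) auto
    moreover have "norm z ^ (M * m) \<le> \<rho> ^ N"
    proof -
      have "norm z ^ (M * m) \<le> \<rho> ^ (M * m)" using z by (intro power_mono) auto
      also have "\<dots> \<le> \<rho> ^ N" using \<rho> by (intro power_increasing) (auto simp: N_def)
      finally show ?thesis .
    qed
    ultimately have bound: "norm z ^ (M * m) * norm (1 + poly X z) ^ m \<le> \<rho> ^ N * 2 ^ m"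
      using \<rho> by (intro mult_mono) auto
    have "norm (poly R z) ^ m = norm (poly (R ^ m) z)" by (simp add: norm_power)
    also have "\<dots> = 4 ^ N / fact N * (norm z ^ (M * m) * norm (1 + poly X z) ^ m)"
      unfolding pow by (simp add: norm_mult norm_divide norm_power)
    also have "\<dots> \<le> 4 ^ N / fact N * (\<rho> ^ N * 2 ^ m)"
      by (rule mult_left_mono[OF bound]) simp
    also have "\<dots> = 2 ^ m * (inverse (fact N) * (4 * \<rho>) ^ N)"
      unfolding power_mult_distrib divide_inverse by (simp only: mult_ac)
    also have "\<dots> < \<eta> ^ m" using N0 by blast
    finally have "norm (poly R z) ^ m < \<eta> ^ m" .
    then show ?thesis using \<eta> power_less_imp_less_base less_imp_le by meson
  qed
  have "degree X \<le> Suc (degree h)"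
    using degree_smult_le[of "fact N / (of_nat m * 4 ^ N)" "pCons 0 S"] degree_pCons_le[of 0 S] degree_antideriv_quotient[of N h]
    by (simp add: X_def S_def)
  then have "degree (1 + X) \<le> Suc (degree h)" by (intro degree_add_le) auto
  then have "degree R \<le> M + Suc (degree h)"
    unfolding R_def
    by (intro order_trans[OF degree_smult_le] order_trans[OF degree_mult_le] add_mono degree_monom_le)
  then have "(m - 1) * degree R + L \<le> (m - 1) * (M + Suc (degree h)) + L"
    by (intro add_mono mult_le_mono order_refl)
  also have "\<dots> = (m - 1) * M + ((m - 1) * (1 + degree h) + L)"
    by (simp add: add_mult_distrib2)
  also have "\<dots> \<le> (m - 1) * M + M"
    by (rule add_left_mono) (rule degM)
  also have "\<dots> < N" using m by (cases m) (auto simp: N_def)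
  finally show ?thesis using small close by blast
qed

section \<open>Derivatives of products of perturbed polynomials\<close>

text \<open>
  A word \<open>w\<close> in the variable indices stands for the monomial \<open>\<Prod>i\<leftarrow>w. x i\<close>. If the factors of such a
  product are perturbed by multiples of \<open>R\<close>, the only term with as many factors \<open>R\<close> as letters is the
  one subtracted here; each other term trades a factor \<open>R\<close> for some \<open>p i\<close>, of degree at most \<open>K\<close>. For
  the empty word the difference is \<open>0\<close>, in agreement with the truncated subtraction in the bound.
\<close>
lemma degree_word_perturbation:
  fixes p :: "nat \<Rightarrow> complex poly" and \<kappa> :: "nat \<Rightarrow> complex"
  assumes "\<And>i. i \<in> set w \<Longrightarrow> degree (p i) \<le> K"
  shows "degree (\<Prod>i\<leftarrow>w. p i + smult (\<kappa> i) R) \<le> length w * (degree R + K)"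
    and "degree ((\<Prod>i\<leftarrow>w. p i + smult (\<kappa> i) R) - smult (\<Prod>i\<leftarrow>w. \<kappa> i) (R ^ length w))
      \<le> (length w - 1) * (degree R + K) + K"
proof -
  let ?f = "\<lambda>i. p i + smult (\<kappa> i) R"
  have "degree (prod_list (map ?f w)) \<le> length w * (degree R + K) \<and>
      degree (prod_list (map ?f w) - smult (prod_list (map \<kappa> w)) (R ^ length w))
      \<le> (length w - 1) * (degree R + K) + K"
    using assms
  proof (induction w)
    case (Cons i w)
    let ?P = "prod_list (map ?f w)"
    let ?E = "?P - smult (prod_list (map \<kappa> w)) (R ^ length w)"
    have P: "degree ?P \<le> length w * (degree R + K)"
      and E: "degree ?E \<le> (length w - 1) * (degree R + K) + K" using Cons by auto
    have pi: "degree (p i) \<le> K" using Cons.prems by simp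
    have "degree (?f i) \<le> degree R + K"
      using pi degree_smult_le[of "\<kappa> i" R] by (intro degree_add_le) auto
    then have 1: "degree (?f i * ?P) \<le> length (i # w) * (degree R + K)"
      using P by (intro order_trans[OF degree_mult_le]) simp
    have "degree (p i * ?P) \<le> length w * (degree R + K) + K"
      using pi P by (intro order_trans[OF degree_mult_le]) simp
    moreover have "degree (smult (\<kappa> i) (R * ?E)) \<le> length w * (degree R + K) + K"
    proof (cases w)
      case Nil
      then show ?thesis by (simp add: pCons_one)
    next
      case (Cons j v)
      have "degree (smult (\<kappa> i) (R * ?E)) \<le> degree R + degree ?E"
        using degree_smult_le degree_mult_le order_trans by blast
      then show ?thesis using E Cons by simp
    qed
    ultimately have "degree (p i * ?P + smult (\<kappa> i) (R * ?E)) \<le> length w * (degree R + K) + K"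
      by (rule degree_add_le)
    moreover have "?f i * ?P - smult (\<kappa> i * prod_list (map \<kappa> w)) (R ^ Suc (length w))
        = p i * ?P + smult (\<kappa> i) (R * ?E)"
      by (simp add: distrib_right right_diff_distrib smult_diff_right)
    ultimately have "degree (?f i * ?P - smult (\<kappa> i * prod_list (map \<kappa> w)) (R ^ Suc (length w)))
        \<le> length w * (degree R + K) + K"
      by (simp only:)
    with 1 show ?case by simp
  qed (simp add: pCons_one)
  then show "degree (prod_list (map ?f w)) \<le> length w * (degree R + K)"
    "degree (prod_list (map ?f w) - smult (prod_list (map \<kappa> w)) (R ^ length w))
      \<le> (length w - 1) * (degree R + K) + K" by auto
qed

lemma higher_pderiv_word_perturbation:
  fixes p :: "nat \<Rightarrow> complex poly" and \<kappa> :: "nat \<Rightarrow> complex"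
  assumes K: "\<And>i. i \<in> set w \<Longrightarrow> degree (p i) \<le> K"
    and w: "length w \<le> m" and N: "(m - 1) * degree R + m * K < N" and m: "1 \<le> m"
  shows "(pderiv ^^ N) (\<Prod>i\<leftarrow>w. p i + smult (\<kappa> i) R) =
    (if length w = m then smult (\<Prod>i\<leftarrow>w. \<kappa> i) ((pderiv ^^ N) (R ^ m)) else 0)"
proof -
  let ?P = "\<Prod>i\<leftarrow>w. p i + smult (\<kappa> i) R"
  let ?M = "smult (\<Prod>i\<leftarrow>w. \<kappa> i) (R ^ length w)"
  have mK: "(m - 1) * (degree R + K) + K = (m - 1) * degree R + m * K"
    using m by (cases m) (auto simp: algebra_simps)
  show ?thesis
  proof (cases "length w = m")
    case True
    have "degree (?P - ?M) \<le> (length w - 1) * (degree R + K) + K"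
      using degree_word_perturbation(2)[of w p K \<kappa> R] K by blast
    then have "degree (?P - ?M) < N" using N mK True by simp
    then have "(pderiv ^^ N) (?P - ?M) = 0" by (rule higher_pderiv_eq_0)
    then have "(pderiv ^^ N) (?M + (?P - ?M)) = (pderiv ^^ N) ?M"
      by (simp only: higher_pderiv_add add_0_right)
    then show ?thesis using True by (simp add: higher_pderiv_smult del: funpow.simps)
  next
    case False
    have "degree ?P \<le> length w * (degree R + K)"
      using degree_word_perturbation(1)[of w p K \<kappa> R] K by blast
    also have "\<dots> \<le> (m - 1) * (degree R + K)" using False w by (intro mult_le_mono) auto
    finally have "degree ?P < N" using N mK by simp
    then show ?thesis using False by (simp add: higher_pderiv_eq_0)
  qed
qed


section \<open>Open and dense conditions on sequences of entire functions\<close>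

text \<open>
  Taking \<open>e\<close> strictly below the tolerance \<open>1 / Suc k\<close> leaves room for perturbations, which makes the
  condition open.
\<close>
definition derivative_hits ::
    "nat \<Rightarrow> nat \<Rightarrow> (nat \<Rightarrow> complex) \<Rightarrow> complex poly \<Rightarrow> nat \<Rightarrow> (nat \<Rightarrow> complex \<Rightarrow> complex) set" where
  "derivative_hits m n \<kappa> q k =
     {F. \<exists>N. \<exists>e < 1 / Suc k. \<forall>w. set w \<subseteq> {..<n} \<and> length w \<le> m \<longrightarrow>
        (\<forall>z\<in>cball 0 (real k). norm ((deriv ^^ N) (\<lambda>z. \<Prod>i\<leftarrow>w. F i z) z
           - (if length w = m then (\<Prod>i\<leftarrow>w. \<kappa> i) * poly q z else 0)) \<le> e)}"

definition entry_hits :: "complex poly \<Rightarrow> nat \<Rightarrow> (nat \<Rightarrow> complex \<Rightarrow> complex) set" where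
  "entry_hits q k = {F. \<exists>i. \<exists>e < 1 / Suc k. \<forall>z\<in>cball 0 (real k). norm (F i z - poly q z) \<le> e}"

lemma norm_word_le:
  fixes \<kappa> :: "'i \<Rightarrow> complex" and B :: real
  assumes "\<And>i. i \<in> set w \<Longrightarrow> norm (\<kappa> i) \<le> B"
  shows "norm (\<Prod>i\<leftarrow>w. \<kappa> i) \<le> B ^ length w"
  using assms
proof (induction w)
  case (Cons i w)
  then have "norm (\<kappa> i) \<le> B" "norm (\<Prod>i\<leftarrow>w. \<kappa> i) \<le> B ^ length w" by auto
  then show ?case by (auto simp: norm_mult intro!: mult_mono intro: order_trans[OF norm_ge_zero])
qed simp

lemma norm_word_diff_le:
  fixes x y :: "'i \<Rightarrow> complex" and B \<delta> :: real
  assumes "\<And>i. i \<in> set w \<Longrightarrow> norm (x i) \<le> B" "\<And>i. i \<in> set w \<Longrightarrow> norm (y i) \<le> B"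
    and "\<And>i. i \<in> set w \<Longrightarrow> norm (x i - y i) \<le> \<delta>" and "1 \<le> B" "0 \<le> \<delta>"
  shows "norm ((\<Prod>i\<leftarrow>w. x i) - (\<Prod>i\<leftarrow>w. y i)) \<le> length w * \<delta> * B ^ length w"
  using assms(1-3)
proof (induction w)
  case (Cons i w)
  let ?x = "\<Prod>i\<leftarrow>w. x i" and ?y = "\<Prod>i\<leftarrow>w. y i" and ?l = "length w"
  have IH: "norm (?x - ?y) \<le> ?l * \<delta> * B ^ ?l" using Cons by auto
  have y: "norm ?y \<le> B ^ ?l" using Cons.prems by (intro norm_word_le) auto
  have i: "norm (x i) \<le> B" "norm (x i - y i) \<le> \<delta>" using Cons.prems by auto
  have "norm (x i * ?x - y i * ?y) = norm (x i * (?x - ?y) + (x i - y i) * ?y)"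
    by (simp add: algebra_simps)
  also have "\<dots> \<le> norm (x i) * norm (?x - ?y) + norm (x i - y i) * norm ?y"
    by (metis norm_mult norm_triangle_ineq)
  also have "\<dots> \<le> B * (?l * \<delta> * B ^ ?l) + \<delta> * B ^ ?l"
    using IH y i assms(4,5) by (intro add_mono mult_mono) auto
  also have "\<dots> \<le> B * (?l * \<delta> * B ^ ?l) + \<delta> * B ^ Suc ?l"
    using assms(4,5) by (intro add_left_mono mult_left_mono power_increasing) auto
  also have "\<dots> = Suc ?l * \<delta> * B ^ Suc ?l" by (simp add: algebra_simps)
  finally show ?case by simp
qed simp

lemma holomorphic_word:
  assumes "\<And>i::nat. F i holomorphic_on S"
  shows "(\<lambda>z. \<Prod>i\<leftarrow>w. F i z) holomorphic_on S"
  by (induction w) (auto intro!: holomorphic_intros assms)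

lemma poly_word: "poly (\<Prod>i\<leftarrow>w. f i) z = (\<Prod>i\<leftarrow>w. poly (f i) z)"
  by (induction w) auto

lemma tuple_open_entry_hits: "tuple_open (entry_hits q k)"
  unfolding tuple_open_def
proof (intro ballI impI)
  fix F assume "F \<in> entry_hits q k"
  then obtain i e where e: "e < 1 / Suc k" "\<And>z. z \<in> cball 0 (real k) \<Longrightarrow> norm (F i z - poly q z) \<le> e"
    unfolding entry_hits_def by blast
  obtain t where t: "e < t" "t < 1 / Suc k" using dense[OF e(1)] by blast
  define s where "s = t - e"
  have s: "0 < s" "e + s < 1 / Suc k" using t by (simp_all add: s_def)
  have "tuple_ball F (max (Suc i) k) s \<subseteq> entry_hits q k"
  proof
    fix G assume G: "G \<in> tuple_ball F (max (Suc i) k) s"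
    have "norm (G i z - poly q z) \<le> e + s" if z: "z \<in> cball 0 (real k)" for z
    proof -
      have "norm (G i z - F i z) \<le> s" using G z by (auto simp: tuple_ball_def)
      then show ?thesis
        using e(2)[OF z] norm_triangle_ineq[of "G i z - F i z" "F i z - poly q z"] by simp
    qed
    then show "G \<in> entry_hits q k" unfolding entry_hits_def using s(2) by blast
  qed
  then show "\<exists>n. \<exists>\<delta>>0. tuple_ball F n \<delta> \<subseteq> entry_hits q k" using s(1) by blast
qed

lemma poly_dense_entry_hits: "poly_dense (entry_hits q k)"
  unfolding poly_dense_def
proof (intro allI impI)
  fix p :: "nat \<Rightarrow> complex poly" and n and \<delta> :: real assume \<delta>: "0 < \<delta>"
  have "(\<lambda>i. poly ((p(n := q)) i)) \<in> entry_hits q k"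
    unfolding entry_hits_def
    by (intro CollectI exI[of _ n] exI[of _ 0]) auto
  moreover have "(\<lambda>i. poly ((p(n := q)) i)) \<in> tuple_ball (\<lambda>i. poly (p i)) n \<delta>"
    using \<delta> by (auto simp: tuple_ball_def poly_holomorphic_on)
  ultimately show "\<exists>q'. (\<lambda>i. poly (q' i)) \<in> entry_hits q k \<inter> tuple_ball (\<lambda>i. poly (p i)) n \<delta>"
    by blast
qed

text \<open>
  Products of boundedly many entries depend continuously on the entries, uniformly over the finitely
  many words, and by Cauchy's estimate so do their \<open>N\<close>-th derivatives, on a disc smaller by \<open>1\<close>.
\<close>
lemma tuple_open_derivative_hits: "tuple_open (derivative_hits m n \<kappa> q k)"
  unfolding tuple_open_def
proof (intro ballI impI)
  fix F assume F: "F \<in> derivative_hits m n \<kappa> q k" and hol: "\<forall>i. F i holomorphic_on UNIV"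
  let ?t = "\<lambda>w z. if length w = m then (\<Prod>i\<leftarrow>w. \<kappa> i) * poly q z else 0"
  obtain N e where e: "e < 1 / Suc k" and N: "\<And>w z. set w \<subseteq> {..<n} \<Longrightarrow> length w \<le> m \<Longrightarrow>
      z \<in> cball 0 (real k) \<Longrightarrow> norm ((deriv ^^ N) (\<lambda>z. \<Prod>i\<leftarrow>w. F i z) z - ?t w z) \<le> e"
    using F unfolding derivative_hits_def by blast
  have "compact (F i ` cball 0 (real (Suc k)))" for i
    using hol by (intro compact_continuous_image holomorphic_on_imp_continuous_on)
      (auto intro: holomorphic_on_subset)
  then have "bounded (\<Union>i<n. F i ` cball 0 (real (Suc k)))"
    by (intro bounded_UN) (auto intro: compact_imp_bounded)
  then obtain b where b: "\<And>i z. i < n \<Longrightarrow> z \<in> cball 0 (real (Suc k)) \<Longrightarrow> norm (F i z) \<le> b"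
    unfolding bounded_iff by blast
  define B where "B = max b 0 + 1"
  have B: "1 \<le> B" by (simp add: B_def)
  obtain t where t: "e < t" "t < 1 / Suc k" using dense[OF e] by blast
  define s where "s = t - e"
  have s: "0 < s" "e + s < 1 / Suc k" using t by (simp_all add: s_def)
  define D where "D = fact N * (real m * B ^ m) + 1"
  have D: "0 < D" using B by (simp add: D_def add_nonneg_pos)
  define \<delta> where "\<delta> = min 1 (s / D)"
  have \<delta>: "0 < \<delta>" "\<delta> \<le> 1" using s D by (auto simp: \<delta>_def)
  have \<delta>s: "fact N * (real m * \<delta> * B ^ m) \<le> s"
  proof -
    have "fact N * (real m * \<delta> * B ^ m) \<le> \<delta> * D" using \<delta> by (simp add: D_def algebra_simps)
    also have "\<dots> \<le> s / D * D" using D by (intro mult_right_mono) (auto simp: \<delta>_def)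
    also have "\<dots> = s" using D by simp
    finally show ?thesis .
  qed
  have "tuple_ball F (max n (Suc k)) \<delta> \<subseteq> derivative_hits m n \<kappa> q k"
  proof
    fix G assume G: "G \<in> tuple_ball F (max n (Suc k)) \<delta>"
    have "norm ((deriv ^^ N) (\<lambda>z. \<Prod>i\<leftarrow>w. G i z) z - ?t w z) \<le> e + s"
      if w: "set w \<subseteq> {..<n}" "length w \<le> m" and z: "z \<in> cball 0 (real k)" for w z
    proof -
      have word: "norm ((\<Prod>i\<leftarrow>w. G i x) - (\<Prod>i\<leftarrow>w. F i x)) \<le> real m * \<delta> * B ^ m"
        if x: "x \<in> cball 0 (real k + 1)" for x
      proof -
        have d: "norm (G i x - F i x) \<le> \<delta>" if "i \<in> set w" for i
          using G w x that by (auto simp: tuple_ball_def)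
        have f: "norm (F i x) \<le> B - 1" if "i \<in> set w" for i
          using b[of i x] w x that by (force simp: B_def)
        have g: "norm (G i x) \<le> B" if "i \<in> set w" for i
          using d[OF that] f[OF that] \<delta>(2) norm_triangle_sub[of "G i x" "F i x"] by linarith
        have "norm ((\<Prod>i\<leftarrow>w. G i x) - (\<Prod>i\<leftarrow>w. F i x)) \<le> real (length w) * \<delta> * B ^ length w"
          using d f g B \<delta> by (intro norm_word_diff_le) force+
        also have "\<dots> \<le> real m * \<delta> * B ^ m"
          using w B \<delta> by (intro mult_mono power_increasing) auto
        finally show ?thesis .
      qed
      have "norm ((deriv ^^ N) (\<lambda>z. \<Prod>i\<leftarrow>w. G i z) z - (deriv ^^ N) (\<lambda>z. \<Prod>i\<leftarrow>w. F i z) z)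
          \<le> fact N * (real m * \<delta> * B ^ m) / 1 ^ N"
        by (rule higher_deriv_diff_cball_bound[where r = "real k"])
          (use word z hol G in \<open>auto intro!: holomorphic_word simp: tuple_ball_def\<close>)
      then show ?thesis
        using N[OF w z] \<delta>s norm_triangle_ineq[of
            "(deriv ^^ N) (\<lambda>z. \<Prod>i\<leftarrow>w. G i z) z - (deriv ^^ N) (\<lambda>z. \<Prod>i\<leftarrow>w. F i z) z"
            "(deriv ^^ N) (\<lambda>z. \<Prod>i\<leftarrow>w. F i z) z - ?t w z"] by simp
    qed
    then show "G \<in> derivative_hits m n \<kappa> q k" unfolding derivative_hits_def using s(2) by blast
  qed
  then show "\<exists>n'. \<exists>\<delta>>0. tuple_ball F n' \<delta> \<subseteq> derivative_hits m n \<kappa> q k" using \<delta>(1) by blast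
qed

text \<open>
  The perturbation is \<open>p i + \<kappa> i R\<close>. In the product over a word of length \<open>m\<close>, only the term
  \<open>(\<Prod>i\<leftarrow>w. \<kappa> i) R\<^sup>m\<close> survives the \<open>N\<close>-th derivative; shorter words are annihilated altogether.
\<close>
lemma poly_dense_derivative_hits:
  assumes m: "1 \<le> m"
  shows "poly_dense (derivative_hits m n \<kappa> q k)"
  unfolding poly_dense_def
proof (intro allI impI)
  fix p :: "nat \<Rightarrow> complex poly" and n' and \<delta> :: real assume \<delta>: "0 < \<delta>"
  define K where "K = (\<Sum>i<n. degree (p i))"
  have K: "degree (p i) \<le> K" if "i < n" for i
    unfolding K_def using that by (intro member_le_sum) auto
  define \<Lambda> where "\<Lambda> = 1 + (\<Sum>i<max n n'. norm (\<kappa> i))"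
  have \<Lambda>1: "1 \<le> \<Lambda>" by (simp add: \<Lambda>_def sum_nonneg)
  have \<Lambda>: "norm (\<kappa> i) \<le> \<Lambda>" if "i < max n n'" for i
  proof -
    have "norm (\<kappa> i) \<le> (\<Sum>i<max n n'. norm (\<kappa> i))" using that by (intro member_le_sum) auto
    then show ?thesis by (simp add: \<Lambda>_def)
  qed
  define e where "e = 1 / (2 * real (Suc k))"
  have e: "0 < e" "e < 1 / Suc k" by (auto simp: e_def field_simps)
  define \<eta> where "\<eta> = min (\<delta> / \<Lambda>) (e / \<Lambda> ^ m)"
  have "0 < \<eta>" using \<delta> e \<Lambda>1 by (auto simp: \<eta>_def)
  from small_poly_with_prescribed_power_deriv[OF m this, where L = "m * K" and r = "real (max k n')" and h = q]
  obtain R N where R: "\<And>z. z \<in> cball 0 (real (max k n')) \<Longrightarrow> norm (poly R z) \<le> \<eta>"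
    and RN: "\<And>z. z \<in> cball 0 (real (max k n')) \<Longrightarrow> norm (poly ((pderiv ^^ N) (R ^ m)) z - poly q z) \<le> \<eta>"
    and N: "(m - 1) * degree R + m * K < N" by blast
  define f where "f = (\<lambda>i. p i + smult (\<kappa> i) R)"
  have "(\<lambda>i. poly (f i)) \<in> tuple_ball (\<lambda>i. poly (p i)) n' \<delta>"
    unfolding tuple_ball_def
  proof (intro CollectI conjI allI impI ballI)
    fix i and z :: complex assume i: "i < n'" and "z \<in> cball 0 (real n')"
    then have "norm (poly R z) \<le> \<delta> / \<Lambda>" using R[of z] by (auto simp: \<eta>_def)
    then have "norm (\<kappa> i) * norm (poly R z) \<le> \<Lambda> * (\<delta> / \<Lambda>)"
      using \<Lambda>[of i] i \<Lambda>1 by (intro mult_mono) auto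
    then show "norm (poly (f i) z - poly (p i) z) \<le> \<delta>"
      using \<Lambda>1 by (simp add: f_def norm_mult)
  qed (auto simp: poly_holomorphic_on)
  moreover have "(\<lambda>i. poly (f i)) \<in> derivative_hits m n \<kappa> q k"
    unfolding derivative_hits_def
  proof (intro CollectI exI[of _ N] exI[of _ e] conjI allI impI ballI e(2))
    fix w and z :: complex assume w: "set w \<subseteq> {..<n} \<and> length w \<le> m" and z: "z \<in> cball 0 (real k)"
    let ?\<Lambda> = "\<Prod>i\<leftarrow>w. \<kappa> i"
    have "(\<lambda>z. \<Prod>i\<leftarrow>w. poly (f i) z) = poly (\<Prod>i\<leftarrow>w. f i)" by (simp add: poly_word fun_eq_iff)
    then have "(deriv ^^ N) (\<lambda>z. \<Prod>i\<leftarrow>w. poly (f i) z) = poly ((pderiv ^^ N) (\<Prod>i\<leftarrow>w. f i))"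
      by (simp add: higher_deriv_poly)
    also have "(pderiv ^^ N) (\<Prod>i\<leftarrow>w. f i) =
        (if length w = m then smult ?\<Lambda> ((pderiv ^^ N) (R ^ m)) else 0)"
      unfolding f_def using w K N m by (intro higher_pderiv_word_perturbation) auto
    finally have eq: "(deriv ^^ N) (\<lambda>z. \<Prod>i\<leftarrow>w. poly (f i) z) z
        = (if length w = m then ?\<Lambda> * poly ((pderiv ^^ N) (R ^ m)) z else 0)" by simp
    show "norm ((deriv ^^ N) (\<lambda>z. \<Prod>i\<leftarrow>w. poly (f i) z) z
        - (if length w = m then ?\<Lambda> * poly q z else 0)) \<le> e"
    proof (cases "length w = m")
      case True
      have "norm (?\<Lambda> * (poly ((pderiv ^^ N) (R ^ m)) z - poly q z)) \<le> \<Lambda> ^ m * (e / \<Lambda> ^ m)"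
        unfolding norm_mult
      proof (intro mult_mono)
        show "norm ?\<Lambda> \<le> \<Lambda> ^ m" using norm_word_le[of w \<kappa> \<Lambda>] \<Lambda> w True by fastforce
        show "norm (poly ((pderiv ^^ N) (R ^ m)) z - poly q z) \<le> e / \<Lambda> ^ m"
          using RN[of z] z by (auto simp: \<eta>_def)
      qed (use \<Lambda>1 in auto)
      then show ?thesis unfolding eq using True \<Lambda>1 by (simp add: right_diff_distrib)
    qed (use eq e in auto)
  qed
  ultimately show "\<exists>q'. (\<lambda>i. poly (q' i)) \<in> derivative_hits m n \<kappa> q k \<inter> tuple_ball (\<lambda>i. poly (p i)) n' \<delta>"
    by blast
qed

section \<open>Generic sequences\<close>

definition rat_complex :: "complex set" where
  "rat_complex = (\<lambda>(a, b). Complex (of_rat a) (of_rat b)) ` UNIV"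

lemma countable_rat_complex: "countable rat_complex"
  unfolding rat_complex_def by (intro countable_image) auto

lemma rat_complex_dense:
  assumes "0 < e"
  shows "\<exists>d\<in>rat_complex. norm (d - c) < e"
proof -
  obtain a where a: "Re c < of_rat a" "of_rat a < Re c + e / 2"
    using of_rat_dense[of "Re c" "Re c + e / 2"] assms by auto
  obtain b where b: "Im c < of_rat b" "of_rat b < Im c + e / 2"
    using of_rat_dense[of "Im c" "Im c + e / 2"] assms by auto
  have "norm (Complex (of_rat a) (of_rat b) - c) \<le> \<bar>of_rat a - Re c\<bar> + \<bar>of_rat b - Im c\<bar>"
    using cmod_le[of "Complex (of_rat a) (of_rat b) - c"] by simp
  also have "\<dots> < e" using a b by simp
  finally show ?thesis unfolding rat_complex_def by force
qed

definition rat_polys :: "complex poly set" where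
  "rat_polys = {p. \<forall>i. coeff p i \<in> rat_complex}"

lemma countable_rat_polys: "countable rat_polys"
proof -
  have "rat_polys \<subseteq> Poly ` lists rat_complex"
  proof
    fix p assume "p \<in> rat_polys"
    then have "coeffs p \<in> lists rat_complex"
      by (auto simp: rat_polys_def coeffs_def)
    then show "p \<in> Poly ` lists rat_complex" by (metis Poly_coeffs imageI)
  qed
  then show ?thesis
    using countable_rat_complex by (meson countable_image countable_lists countable_subset)
qed

lemma zero_in_rat_complex: "0 \<in> rat_complex"
  unfolding rat_complex_def by (rule image_eqI[of _ _ "(0, 0)"]) (auto simp: complex_eq_iff)

text \<open>
  The Taylor series at \<open>0\<close> converges uniformly on discs, and the error from rounding its
  \<open>i\<close>-th coefficient is kept below a geometric sequence.
\<close>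
lemma rat_polys_dense:
  assumes h: "h holomorphic_on UNIV" and e: "0 < e"
  shows "\<exists>q\<in>rat_polys. \<forall>z\<in>cball 0 r. norm (poly q z - h z) < e"
proof -
  define \<rho> where "\<rho> = max r 1"
  have \<rho>: "1 \<le> \<rho>" "r \<le> \<rho>" by (auto simp: \<rho>_def)
  define a where "a n = (deriv ^^ n) h 0 / fact n" for n
  have "compact (h ` cball 0 (2 * \<rho>))"
    using h by (intro compact_continuous_image holomorphic_on_imp_continuous_on)
      (auto intro: holomorphic_on_subset)
  then have "bounded (h ` cball 0 (2 * \<rho>))" by (rule compact_imp_bounded)
  then obtain B where B: "\<And>z. z \<in> cball 0 (2 * \<rho>) \<Longrightarrow> norm (h z) \<le> B"
    unfolding bounded_iff by blast
  have bound: "norm (a n * z ^ n) \<le> B * (1 / 2) ^ n" if z: "z \<in> cball 0 \<rho>" for n z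
  proof -
    have "norm ((deriv ^^ n) h 0) \<le> fact n * B / (2 * \<rho>) ^ n"
      using higher_deriv_cball_bound[of h "2 * \<rho>" 0 B 0 n] h B \<rho> by simp
    then have "norm ((deriv ^^ n) h 0) / fact n \<le> fact n * B / (2 * \<rho>) ^ n / fact n"
      by (rule divide_right_mono) simp
    then have "norm (a n) \<le> B / (2 * \<rho>) ^ n"
      by (simp add: a_def norm_divide)
    then have "norm (a n) * norm (z ^ n) \<le> B / (2 * \<rho>) ^ n * \<rho> ^ n"
      unfolding norm_power using z by (intro mult_mono power_mono) (auto intro: order_trans[OF norm_ge_zero])
    also have "\<dots> = B * (1 / 2) ^ n"
      using \<rho> unfolding power_mult_distrib power_divide by simp
    finally show ?thesis by (simp add: norm_mult)
  qed
  have sums: "(\<lambda>n. a n * z ^ n) sums h z" for z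
    using holomorphic_power_series[of h 0 "norm z + 1" z] h
    by (auto simp: a_def intro: holomorphic_on_subset)
  have "uniform_limit (cball 0 \<rho>) (\<lambda>n z. \<Sum>i<n. a i * z ^ i) (\<lambda>z. suminf (\<lambda>i. a i * z ^ i)) sequentially"
    by (rule Weierstrass_m_test[of _ _ "\<lambda>n. B * (1 / 2) ^ n"])
      (use bound in \<open>auto intro!: summable_mult summable_geometric\<close>)
  moreover have "(\<lambda>z. suminf (\<lambda>i. a i * z ^ i)) = h"
    by (rule ext) (rule sums_unique[OF sums, symmetric])
  ultimately have "uniform_limit (cball 0 \<rho>) (\<lambda>n z. \<Sum>i<n. a i * z ^ i) h sequentially"
    by simp
  from uniform_limitD[OF this, of "e / 2"] e
  have "eventually (\<lambda>n. \<forall>z\<in>cball 0 \<rho>. dist (\<Sum>i<n. a i * z ^ i) (h z) < e / 2) sequentially"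
    by simp
  then obtain n where "\<forall>z\<in>cball 0 \<rho>. dist (\<Sum>i<n. a i * z ^ i) (h z) < e / 2"
    unfolding eventually_sequentially by blast
  then have n: "norm ((\<Sum>i<n. a i * z ^ i) - h z) < e / 2" if "z \<in> cball 0 \<rho>" for z
    using that unfolding dist_norm by blast
  have "\<exists>d\<in>rat_complex. norm (d - a i) < e / (4 * (2 * \<rho>) ^ i)" for i
    using e \<rho> by (intro rat_complex_dense) auto
  then obtain b where b: "\<And>i. b i \<in> rat_complex" "\<And>i. norm (b i - a i) < e / (4 * (2 * \<rho>) ^ i)"
    by metis
  define q where "q = (\<Sum>i<n. monom (b i) i)"
  have "q \<in> rat_polys"
    using b(1) zero_in_rat_complex
    by (auto simp: rat_polys_def q_def coeff_sum if_distrib cong: if_cong)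
  moreover have "norm (poly q z - h z) < e" if z: "z \<in> cball 0 r" for z
  proof -
    have z': "z \<in> cball 0 \<rho>" using z \<rho> by auto
    have "norm (\<Sum>i<n. (b i - a i) * z ^ i) \<le> (\<Sum>i<n. e / 4 * (1 / 2) ^ i)"
    proof (intro sum_norm_le)
      fix i
      have "norm (b i - a i) * norm (z ^ i) \<le> e / (4 * (2 * \<rho>) ^ i) * \<rho> ^ i"
        unfolding norm_power using z' b(2)[of i] e \<rho> by (intro mult_mono power_mono) auto
      also have "\<dots> = e / 4 * (1 / 2) ^ i"
        using \<rho> unfolding power_mult_distrib power_divide by simp
      finally show "norm ((b i - a i) * z ^ i) \<le> e / 4 * (1 / 2) ^ i" by (simp add: norm_mult)
    qed
    also have "\<dots> \<le> e / 4 * 2"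
      unfolding sum_distrib_left[symmetric]
      using e sum_le_suminf[of "\<lambda>i. (1 / 2 :: real) ^ i" "{..<n}"] suminf_geometric[of "1 / 2 :: real"]
      by (intro mult_left_mono) (auto simp: summable_geometric)
    finally have "norm (\<Sum>i<n. (b i - a i) * z ^ i) \<le> e / 2" by simp
    moreover have "poly q z - h z = (\<Sum>i<n. (b i - a i) * z ^ i) + ((\<Sum>i<n. a i * z ^ i) - h z)"
      by (simp add: q_def poly_sum poly_monom sum.distrib sum_subtractf left_diff_distrib)
    ultimately show ?thesis
      using n[OF z'] norm_triangle_ineq[of "\<Sum>i<n. (b i - a i) * z ^ i" "(\<Sum>i<n. a i * z ^ i) - h z"]
      by (smt (verit) field_sum_of_halves)
  qed
  ultimately show ?thesis by blast
qed

text \<open>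
  The numbers \<open>\<kappa>\<^sub>i\<close> in the conditions are the coefficients of a polynomial \<open>p\<close>, so that one countable set
  of polynomials indexes both the numbers and the targets. Only finitely many \<open>\<kappa>\<^sub>i\<close> matter for words
  in \<open>n\<close> letters.
\<close>
definition generic_tuple :: "(nat \<Rightarrow> complex \<Rightarrow> complex) \<Rightarrow> bool" where
  "generic_tuple F \<longleftrightarrow> (\<forall>i. F i holomorphic_on UNIV)
    \<and> (\<forall>m n. \<forall>p\<in>rat_polys. \<forall>q\<in>rat_polys. \<forall>k. 1 \<le> m \<longrightarrow> F \<in> derivative_hits m n (coeff p) q k)
    \<and> (\<forall>q\<in>rat_polys. \<forall>k. F \<in> entry_hits q k)"

lemma ex_generic_tuple: "\<exists>F. generic_tuple F"
proof -
  define \<U> where "\<U> = (\<lambda>(m, n, p, q, k). derivative_hits m n (coeff p) q k) `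
      ({1..} \<times> UNIV \<times> rat_polys \<times> rat_polys \<times> UNIV) \<union> (\<lambda>(q, k). entry_hits q k) ` (rat_polys \<times> UNIV)"
  have "0 \<in> rat_polys" by (simp add: rat_polys_def zero_in_rat_complex)
  then have ne: "\<U> \<noteq> {}" by (auto simp: \<U>_def)
  have count: "countable \<U>"
    unfolding \<U>_def using countable_rat_polys
    by (intro countable_Un countable_image countable_SIGMA) auto
  have "tuple_open U \<and> poly_dense U" if "U \<in> \<U>" for U
    using that unfolding \<U>_def
    by (auto intro: tuple_open_derivative_hits poly_dense_derivative_hits
        tuple_open_entry_hits poly_dense_entry_hits)
  then have "tuple_open (from_nat_into \<U> s)" "poly_dense (from_nat_into \<U> s)" for s
    using from_nat_into[OF ne] by blast+
  then obtain F where F: "\<forall>i. F i holomorphic_on UNIV" "\<forall>s. F \<in> from_nat_into \<U> s"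
    using baire_entire_tuples by blast
  have "F \<in> U" if "U \<in> \<U>" for U
    using F(2) from_nat_into_surj[OF count that] by metis
  moreover have "derivative_hits m n (coeff p) q k \<in> \<U>"
    if "1 \<le> m" "p \<in> rat_polys" "q \<in> rat_polys" for m n p q k
    unfolding \<U>_def using that by (intro UnI1 image_eqI[of _ _ "(m, n, p, q, k)"]) auto
  moreover have "entry_hits q k \<in> \<U>" if "q \<in> rat_polys" for q k
    unfolding \<U>_def using that by (intro UnI2 image_eqI[of _ _ "(q, k)"]) auto
  ultimately have "generic_tuple F" unfolding generic_tuple_def using F(1) by blast
  then show ?thesis by blast
qed

section \<open>Polynomials in the entries of a generic sequence\<close>

abbreviation monomial_val :: "(nat \<Rightarrow>\<^sub>0 nat) \<Rightarrow> (nat \<Rightarrow> complex) \<Rightarrow> complex" where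
  "monomial_val \<mu> x \<equiv> (\<Prod>i\<in>Poly_Mapping.keys \<mu>. x i ^ Poly_Mapping.lookup \<mu> i)"

lemma monomial_val_superset:
  assumes "finite A" "Poly_Mapping.keys \<mu> \<subseteq> A"
  shows "monomial_val \<mu> x = (\<Prod>i\<in>A. x i ^ Poly_Mapping.lookup \<mu> i)"
  using assms by (intro prod.mono_neutral_left) (auto simp: in_keys_iff)

text \<open>
  The monomials are distinct multiplicative functions, so Dedekind's argument on the independence of
  characters applies: if \<open>\<mu>\<close> and \<open>\<nu>\<close> have different exponents of \<open>x\<^sub>i\<close>, they differ at the point \<open>u\<close> with
  \<open>u\<^sub>i = 2\<close> and all other coordinates \<open>1\<close>. Subtracting \<open>\<nu>(u)\<close> times the given relation at \<open>x\<close> from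
  the relation at \<open>x u\<close> eliminates \<open>\<nu>\<close> and keeps \<open>\<mu>\<close>.
\<close>
lemma monomials_linearly_independent:
  fixes c :: "(nat \<Rightarrow>\<^sub>0 nat) \<Rightarrow> complex"
  assumes "finite S" and "\<And>x. (\<Sum>\<mu>\<in>S. c \<mu> * monomial_val \<mu> x) = 0" and "\<mu> \<in> S"
  shows "c \<mu> = 0"
  using assms
proof (induction S arbitrary: c \<mu> rule: finite_induct)
  case (insert \<nu> S)
  have S: "c \<mu> = 0" if \<mu>: "\<mu> \<in> S" for \<mu>
  proof -
    have "\<mu> \<noteq> \<nu>" using \<mu> insert.hyps by blast
    then obtain i where i: "Poly_Mapping.lookup \<mu> i \<noteq> Poly_Mapping.lookup \<nu> i"
      by (meson poly_mapping_eqI)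
    define u :: "nat \<Rightarrow> complex" where "u j = (if j = i then 2 else 1)" for j
    have u: "monomial_val \<xi> u = 2 ^ Poly_Mapping.lookup \<xi> i" for \<xi>
    proof -
      have "monomial_val \<xi> u = (\<Prod>j\<in>insert i (Poly_Mapping.keys \<xi>). u j ^ Poly_Mapping.lookup \<xi> j)"
        by (intro monomial_val_superset) auto
      also have "\<dots> = (\<Prod>j\<in>{i}. u j ^ Poly_Mapping.lookup \<xi> j)"
        by (intro prod.mono_neutral_right) (auto simp: u_def)
      finally show ?thesis by (simp add: u_def)
    qed
    have mult: "monomial_val \<xi> (\<lambda>j. x j * u j) = monomial_val \<xi> x * monomial_val \<xi> u" for \<xi> x
      by (simp add: power_mult_distrib prod.distrib)
    define d where "d \<xi> = c \<xi> * (monomial_val \<xi> u - monomial_val \<nu> u)" for \<xi>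
    have "(\<Sum>\<xi>\<in>S. d \<xi> * monomial_val \<xi> x) = 0" for x
    proof -
      have "(\<Sum>\<xi>\<in>insert \<nu> S. d \<xi> * monomial_val \<xi> x)
          = (\<Sum>\<xi>\<in>insert \<nu> S. c \<xi> * monomial_val \<xi> (\<lambda>j. x j * u j))
            - monomial_val \<nu> u * (\<Sum>\<xi>\<in>insert \<nu> S. c \<xi> * monomial_val \<xi> x)"
        unfolding mult d_def sum_distrib_left sum_subtractf[symmetric]
        by (intro sum.cong) (auto simp: algebra_simps)
      also have "\<dots> = 0" using insert.prems(1) by simp
      finally show ?thesis using insert.hyps by (simp add: d_def)
    qed
    then have "d \<mu> = 0" using insert.IH[of d \<mu>] \<mu> by blast
    moreover have "monomial_val \<mu> u \<noteq> monomial_val \<nu> u"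
      unfolding u using i by (metis of_nat_eq_iff of_nat_numeral of_nat_power power_inject_exp one_less_numeral_iff semiring_norm(76))
    ultimately show ?thesis by (simp add: d_def)
  qed
  show ?case
  proof (cases "\<mu> = \<nu>")
    case True
    have "(\<Sum>\<xi>\<in>S. c \<xi> * monomial_val \<xi> (\<lambda>_. 1)) = 0" using S by simp
    then show ?thesis using insert.prems(1)[of "\<lambda>_. 1"] insert.hyps True by simp
  qed (use S insert.prems in auto)
qed simp

lemma poly_val_nonzero:
  assumes "P \<noteq> 0"
  shows "\<exists>x. poly_val P x \<noteq> 0"
proof (rule ccontr)
  assume "\<nexists>x. poly_val P x \<noteq> 0"
  then have "Poly_Mapping.lookup P \<mu> = 0" if "\<mu> \<in> Poly_Mapping.keys P" for \<mu>
    using monomials_linearly_independent[OF finite_keys _ that, of "Poly_Mapping.lookup P"]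
    by (simp add: poly_val_def)
  then have "Poly_Mapping.lookup P \<mu> = 0" for \<mu>
    by (cases "\<mu> \<in> Poly_Mapping.keys P") (auto simp: in_keys_iff)
  then have "P = 0" by (intro poly_mapping_eqI) simp
  then show False using assms by simp
qed

lemma monomial_as_word:
  "\<exists>w. set w \<subseteq> Poly_Mapping.keys \<mu> \<and> (\<forall>x. monomial_val \<mu> x = (\<Prod>i\<leftarrow>w. x i))"
proof -
  have word: "\<exists>w. set w \<subseteq> A \<and> (\<forall>x :: nat \<Rightarrow> complex. (\<Prod>i\<in>A. x i ^ f i) = (\<Prod>i\<leftarrow>w. x i))"
    if "finite A" for A and f :: "nat \<Rightarrow> nat"
    using that
  proof (induction rule: finite_induct)
    case empty
    then show ?case by (intro exI[of _ "[]"]) simp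
  next
    case (insert a A)
    then obtain w where w: "set w \<subseteq> A" "\<And>x :: nat \<Rightarrow> complex. (\<Prod>i\<in>A. x i ^ f i) = (\<Prod>i\<leftarrow>w. x i)"
      by blast
    show ?case
    proof (intro exI[of _ "replicate (f a) a @ w"] conjI allI)
      show "set (replicate (f a) a @ w) \<subseteq> insert a A" using w(1) by auto
      show "(\<Prod>i\<in>insert a A. x i ^ f i) = (\<Prod>i\<leftarrow>replicate (f a) a @ w. x i)" for x :: "nat \<Rightarrow> complex"
        using insert.hyps w(2)[of x] by (simp add: prod_list_replicate)
    qed
  qed
  show ?thesis by (rule word) simp
qed

text \<open>
  Nonvanishing is an open condition on the finitely many coordinates involved. The coordinates of the
  new point are packaged as the coefficients of a polynomial, the form in which the countably many
  conditions are indexed.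
\<close>
lemma word_sum_nonzero_rat:
  fixes c :: "'a \<Rightarrow> complex" and w :: "'a \<Rightarrow> nat list"
  assumes A: "finite A" and x: "(\<Sum>a\<in>A. c a * (\<Prod>i\<leftarrow>w a. x i)) \<noteq> 0"
  shows "\<exists>p\<in>rat_polys. (\<Sum>a\<in>A. c a * (\<Prod>i\<leftarrow>w a. coeff p i)) \<noteq> 0"
proof -
  have "finite (\<Union>a\<in>A. set (w a))" using A by simp
  then obtain n where n: "\<forall>i\<in>(\<Union>a\<in>A. set (w a)). i < n"
    unfolding finite_nat_set_iff_bounded by blast
  have "\<exists>d\<in>rat_complex. norm (d - x i) < inverse (real (Suc j))" for i j
    by (intro rat_complex_dense) simp
  then obtain b where b: "\<And>i j. b i j \<in> rat_complex" "\<And>i j. norm (b i j - x i) < inverse (real (Suc j))"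
    by metis
  have lim: "(\<lambda>j. b i j) \<longlonglongrightarrow> x i" for i
  proof (rule LIM_zero_cancel)
    show "(\<lambda>j. b i j - x i) \<longlonglongrightarrow> 0"
      by (rule LIMSEQ_norm_0) (use b(2)[of i] in \<open>simp add: inverse_eq_divide\<close>)
  qed
  have "(\<lambda>j. \<Prod>i\<leftarrow>v. b i j) \<longlonglongrightarrow> (\<Prod>i\<leftarrow>v. x i)" for v
    by (induction v) (auto intro!: tendsto_intros lim)
  then have "(\<lambda>j. \<Sum>a\<in>A. c a * (\<Prod>i\<leftarrow>w a. b i j)) \<longlonglongrightarrow> (\<Sum>a\<in>A. c a * (\<Prod>i\<leftarrow>w a. x i))"
    by (intro tendsto_intros)
  then have "eventually (\<lambda>j. (\<Sum>a\<in>A. c a * (\<Prod>i\<leftarrow>w a. b i j)) \<noteq> 0) sequentially"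
    using x by (rule tendsto_imp_eventually_ne)
  then obtain j where j: "(\<Sum>a\<in>A. c a * (\<Prod>i\<leftarrow>w a. b i j)) \<noteq> 0"
    unfolding eventually_sequentially by blast
  define p where "p = (\<Sum>i<n. monom (b i j) i)"
  have cp: "coeff p i = (if i < n then b i j else 0)" for i
    by (auto simp: p_def coeff_sum)
  then have "p \<in> rat_polys" using b(1) zero_in_rat_complex by (auto simp: rat_polys_def)
  moreover have "(\<Sum>a\<in>A. c a * (\<Prod>i\<leftarrow>w a. coeff p i)) = (\<Sum>a\<in>A. c a * (\<Prod>i\<leftarrow>w a. b i j))"
  proof (intro sum.cong refl arg_cong2[where f = "(*)"] arg_cong[where f = prod_list] map_cong)
    fix a i assume "a \<in> A" "i \<in> set (w a)"
    then show "coeff p i = b i j" using n cp by auto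
  qed
  ultimately show ?thesis using j by metis
qed

lemma higher_deriv_linear_combination:
  assumes "finite A" "\<And>a. a \<in> A \<Longrightarrow> f a holomorphic_on UNIV"
  shows "(deriv ^^ N) (\<lambda>z. \<Sum>a\<in>A. c a * f a z) z = (\<Sum>a\<in>A. c a * (deriv ^^ N) (f a) z)"
  using assms
proof (induction A rule: finite_induct)
  case (insert a A)
  have "(deriv ^^ N) (\<lambda>z. c a * f a z + (\<Sum>a\<in>A. c a * f a z)) z
      = (deriv ^^ N) (\<lambda>z. c a * f a z) z + (deriv ^^ N) (\<lambda>z. \<Sum>a\<in>A. c a * f a z) z"
    using insert.prems by (intro higher_deriv_add[where S = UNIV]) (auto intro!: holomorphic_intros)
  also have "(deriv ^^ N) (\<lambda>z. c a * f a z) z = c a * (deriv ^^ N) (f a) z"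
    using insert.prems by (intro higher_deriv_cmult[where A = UNIV]) auto
  finally show ?case using insert by simp
qed simp

text \<open>
  The words may repeat and cancel, so the relevant degree \<open>m\<close> is the largest length for which the
  homogeneous part \<open>Q m\<close> is nonzero as a function; the longer words then contribute nothing. With
  \<open>Q m\<close> nonzero at the coefficients of \<open>p\<close>, say with value \<open>v\<close>, the condition for words of length at
  most \<open>m\<close> with target \<open>q \<approx> h / v\<close> makes a derivative of the combination approximate \<open>h\<close>.
\<close>
lemma hypercyclic_word_combination:
  fixes c :: "'a \<Rightarrow> complex" and w :: "'a \<Rightarrow> nat list"
  assumes F: "generic_tuple F" and A: "finite A" and w: "\<And>a. a \<in> A \<Longrightarrow> w a \<noteq> []"
    and x: "(\<Sum>a\<in>A. c a * (\<Prod>i\<leftarrow>w a. x i)) \<noteq> 0"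
  shows "hypercyclic entire_topology deriv (\<lambda>z. \<Sum>a\<in>A. c a * (\<Prod>i\<leftarrow>w a. F i z))"
proof -
  have holF: "F i holomorphic_on UNIV" for i using F by (simp add: generic_tuple_def)
  define A\<^sub>d where "A\<^sub>d d = {a \<in> A. length (w a) = d}" for d
  define Q where "Q d y = (\<Sum>a\<in>A\<^sub>d d. c a * (\<Prod>i\<leftarrow>w a. y i))" for d and y :: "nat \<Rightarrow> complex"
  define D where "D = {d. \<exists>y. Q d y \<noteq> 0}"
  have D_sub: "D \<subseteq> (\<lambda>a. length (w a)) ` A"
  proof
    fix d assume "d \<in> D"
    then obtain y where "Q d y \<noteq> 0" by (auto simp: D_def)
    then have "A\<^sub>d d \<noteq> {}" by (auto simp: Q_def)
    then show "d \<in> (\<lambda>a. length (w a)) ` A" by (auto simp: A\<^sub>d_def)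
  qed
  have group: "(\<Sum>a\<in>B. c a * (\<Prod>i\<leftarrow>w a. y i)) = (\<Sum>d\<in>(\<lambda>a. length (w a)) ` B. Q d y)"
    if "B \<subseteq> A" "\<And>a b. a \<in> B \<Longrightarrow> b \<in> A \<Longrightarrow> length (w b) = length (w a) \<Longrightarrow> b \<in> B" for B y
  proof -
    have "finite B" using A that(1) finite_subset by blast
    then have "(\<Sum>a\<in>B. c a * (\<Prod>i\<leftarrow>w a. y i))
        = (\<Sum>d\<in>(\<lambda>a. length (w a)) ` B. \<Sum>a\<in>{a \<in> B. length (w a) = d}. c a * (\<Prod>i\<leftarrow>w a. y i))"
      by (rule sum.image_gen)
    also have "\<dots> = (\<Sum>d\<in>(\<lambda>a. length (w a)) ` B. Q d y)"
      unfolding Q_def A\<^sub>d_def using that by (intro sum.cong) auto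
    finally show ?thesis .
  qed
  have fin: "finite D" using D_sub A by (meson finite_imageI finite_subset)
  have "D \<noteq> {}"
  proof
    assume "D = {}"
    then have "Q d x = 0" for d by (auto simp: D_def)
    then show False using group[of A x] x by simp
  qed
  define m where "m = Max D"
  have mD: "m \<in> D" unfolding m_def using fin \<open>D \<noteq> {}\<close> by (rule Max_in)
  then have m: "1 \<le> m" using D_sub w by (auto simp: Suc_le_eq)
  have above: "Q d y = 0" if "m < d" for d y
    using Max_ge[OF fin, of d] that unfolding m_def D_def by fastforce
  obtain y where "Q m y \<noteq> 0" using mD by (auto simp: D_def)
  then obtain p where p: "p \<in> rat_polys" "Q m (coeff p) \<noteq> 0"
    unfolding Q_def using word_sum_nonzero_rat[of "A\<^sub>d m" c y w] A by (auto simp: A\<^sub>d_def)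
  define v where "v = Q m (coeff p)"
  have v: "v \<noteq> 0" using p(2) by (simp add: v_def)
  have "finite (\<Union>a\<in>A. set (w a))" using A by simp
  then obtain n where n: "\<forall>i\<in>(\<Union>a\<in>A. set (w a)). i < n"
    unfolding finite_nat_set_iff_bounded by blast
  define B where "B = {a \<in> A. length (w a) \<le> m}"
  have B: "finite B" using A by (simp add: B_def)
  define W where "W a z = (\<Prod>i\<leftarrow>w a. F i z)" for a z
  have holW: "W a holomorphic_on UNIV" for a
    unfolding W_def using holF by (rule holomorphic_word)
  have FB: "(\<lambda>z. \<Sum>a\<in>A. c a * (\<Prod>i\<leftarrow>w a. F i z)) = (\<lambda>z. \<Sum>a\<in>B. c a * W a z)"
  proof
    fix z
    have "(\<Sum>a\<in>A - B. c a * (\<Prod>i\<leftarrow>w a. F i z)) = (\<Sum>d\<in>(\<lambda>a. length (w a)) ` (A - B). Q d (\<lambda>i. F i z))"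
      by (rule group) (auto simp: B_def)
    also have "\<dots> = 0" by (intro sum.neutral) (auto simp: B_def intro!: above)
    finally show "(\<Sum>a\<in>A. c a * (\<Prod>i\<leftarrow>w a. F i z)) = (\<Sum>a\<in>B. c a * W a z)"
      using sum.subset_diff[of B A "\<lambda>a. c a * (\<Prod>i\<leftarrow>w a. F i z)"] A by (simp add: B_def W_def)
  qed
  define C where "C = (\<Sum>a\<in>B. norm (c a))"
  have C: "0 \<le> C" by (simp add: C_def sum_nonneg)
  show ?thesis
    unfolding FB
  proof (rule hypercyclic_derivI)
    show "(\<lambda>z. \<Sum>a\<in>B. c a * W a z) holomorphic_on UNIV"
      using holW by (intro holomorphic_intros)
    fix h r and e :: real assume h: "h holomorphic_on UNIV" and e: "0 < e"
    have "(\<lambda>z. h z / v) holomorphic_on UNIV" using h v by (intro holomorphic_intros) auto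
    then obtain q where q: "q \<in> rat_polys" "\<And>z. z \<in> cball 0 r \<Longrightarrow> norm (poly q z - h z / v) < e / (2 * norm v)"
      using rat_polys_dense[of "\<lambda>z. h z / v" "e / (2 * norm v)" r] e v by auto
    obtain k1 where k1: "r \<le> real k1" using real_arch_simple by blast
    obtain k2 where k2: "2 * C / e < real k2" using reals_Archimedean2 by blast
    define k where "k = max k1 k2"
    have k: "r \<le> real k" "C * (1 / Suc k) < e / 2"
    proof -
      show "r \<le> real k" using k1 by (simp add: k_def)
      have "2 * C / e < real (Suc k)" using k2 by (simp add: k_def)
      then show "C * (1 / Suc k) < e / 2" using e by (simp add: field_simps)
    qed
    have "F \<in> derivative_hits m n (coeff p) q k"
      using F m p(1) q(1) by (simp add: generic_tuple_def)
    then obtain N e' where e': "e' < 1 / Suc k" and N: "\<And>u z. set u \<subseteq> {..<n} \<Longrightarrow> length u \<le> m \<Longrightarrow>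
        z \<in> cball 0 (real k) \<Longrightarrow> norm ((deriv ^^ N) (\<lambda>z. \<Prod>i\<leftarrow>u. F i z) z
          - (if length u = m then (\<Prod>i\<leftarrow>u. coeff p i) * poly q z else 0)) \<le> e'"
      unfolding derivative_hits_def by blast
    have "norm ((deriv ^^ N) (\<lambda>z. \<Sum>a\<in>B. c a * W a z) z - h z) < e" if z: "z \<in> cball 0 r" for z
    proof -
      let ?t = "\<lambda>a. if length (w a) = m then (\<Prod>i\<leftarrow>w a. coeff p i) * poly q z else 0"
      have "(\<Sum>a\<in>B. c a * ?t a) = (\<Sum>a\<in>A\<^sub>d m. c a * ((\<Prod>i\<leftarrow>w a. coeff p i) * poly q z))"
        using B by (intro sum.mono_neutral_cong_right) (auto simp: B_def A\<^sub>d_def)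
      also have "\<dots> = v * poly q z"
        by (simp add: v_def Q_def sum_distrib_right mult.assoc)
      finally have t: "(\<Sum>a\<in>B. c a * ?t a) = v * poly q z" .
      have "norm (c a * ((deriv ^^ N) (W a) z - ?t a)) \<le> norm (c a) * (1 / Suc k)" if a: "a \<in> B" for a
      proof -
        have "norm ((deriv ^^ N) (W a) z - ?t a) \<le> e'"
          unfolding W_def using N[of "w a" z] a n z k(1) by (force simp: B_def)
        then show ?thesis unfolding norm_mult using e' by (intro mult_left_mono) auto
      qed
      then have "norm (\<Sum>a\<in>B. c a * ((deriv ^^ N) (W a) z - ?t a)) \<le> C * (1 / Suc k)"
        unfolding C_def sum_distrib_right by (rule sum_norm_le)
      also have "\<dots> < e / 2" by (rule k(2))
      finally have "norm (\<Sum>a\<in>B. c a * ((deriv ^^ N) (W a) z - ?t a)) < e / 2" .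
      moreover have "(\<Sum>a\<in>B. c a * ((deriv ^^ N) (W a) z - ?t a))
          = (deriv ^^ N) (\<lambda>z. \<Sum>a\<in>B. c a * W a z) z - v * poly q z"
        unfolding higher_deriv_linear_combination[OF B holW] right_diff_distrib sum_subtractf t ..
      moreover have "norm (v * poly q z - h z) < e / 2"
      proof -
        have "v * poly q z - h z = v * (poly q z - h z / v)" using v by (simp add: field_simps)
        then have "norm (v * poly q z - h z) = norm v * norm (poly q z - h z / v)"
          by (simp add: norm_mult)
        also have "\<dots> < norm v * (e / (2 * norm v))"
          using q(2)[OF z] v by (intro mult_strict_left_mono) auto
        also have "\<dots> = e / 2" using v by simp
        finally show ?thesis .
      qed
      ultimately have "norm ((deriv ^^ N) (\<lambda>z. \<Sum>a\<in>B. c a * W a z) z - h z) < e / 2 + e / 2"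
        by (intro norm_diff_triangle_less[where y = "v * poly q z"]) (simp_all only:)
      then show ?thesis by simp
    qed
    then show "\<exists>N. \<forall>z\<in>cball 0 r. norm ((deriv ^^ N) (\<lambda>z. \<Sum>a\<in>B. c a * W a z) z - h z) < e" by blast
  qed
qed

lemma not_hypercyclic_zero: "\<not> hypercyclic entire_topology deriv (\<lambda>_. 0)"
proof
  assume "hypercyclic entire_topology deriv (\<lambda>_. 0)"
  then have cl: "(\<lambda>_. 1) \<in> entire_topology closure_of {(deriv ^^ n) (\<lambda>_. 0) | n. True}"
    by (simp add: hypercyclic_def dense_in_def topspace_entire_topology)
  define T :: "(complex \<Rightarrow> complex) set" where "T = {f. f holomorphic_on UNIV \<and> norm (f 0 - 1) < 1}"
  have "openin entire_topology T"
    unfolding openin_entire_topology_iff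
  proof (intro conjI ballI)
    fix f assume f: "f \<in> T"
    have "g \<in> T" if "g holomorphic_on UNIV" "\<forall>z\<in>cball 0 0. norm (g z - f z) < 1 - norm (f 0 - 1)" for g
      using that norm_triangle_ineq[of "g 0 - f 0" "f 0 - 1"] by (simp add: T_def)
    then show "\<exists>r e. 0 < e \<and> (\<forall>g. g holomorphic_on UNIV \<longrightarrow>
        (\<forall>z\<in>cball 0 r. norm (g z - f z) < e) \<longrightarrow> g \<in> T)"
      using f by (intro exI[of _ 0] exI[of _ "1 - norm (f 0 - 1)"]) (simp add: T_def)
  qed (auto simp: T_def)
  moreover have "(\<lambda>_. 1) \<in> T" by (simp add: T_def)
  ultimately obtain n where "(deriv ^^ n) (\<lambda>_. 0) \<in> T"
    using cl unfolding in_closure_of by blast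
  then show False by (simp add: T_def split: if_splits)
qed

lemma monomial_val_zero:
  assumes "\<mu> \<noteq> 0"
  shows "monomial_val \<mu> (\<lambda>_. 0) = 0"
proof -
  obtain i where "i \<in> Poly_Mapping.keys \<mu>" using assms by (metis keys_eq_empty ex_in_conv)
  then show ?thesis by (intro prod_zero) (auto simp: in_keys_iff intro!: bexI[of _ i])
qed

lemma poly_val_zero: "poly_val P (\<lambda>_. 0) = Poly_Mapping.lookup P 0"
proof -
  have "Poly_Mapping.lookup P \<mu> * monomial_val \<mu> (\<lambda>_. 0)
      = (if \<mu> = 0 then Poly_Mapping.lookup P 0 else 0)" for \<mu>
    using monomial_val_zero[of \<mu>] by (cases "\<mu> = 0") simp_all
  then show ?thesis by (simp add: poly_val_def in_keys_iff)
qed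

text \<open>
  If \<open>y\<close> repeats entries, a nonzero polynomial \<open>P\<close> may collapse to the zero function, so in general
  there are two alternatives. If \<open>y\<close> is injective and \<open>P\<close> is nonzero, every point \<open>x'\<close> with
  \<open>P(x') \<noteq> 0\<close> can be prescribed at the indices of the entries, and the first alternative is excluded.
\<close>
lemma poly_fun_generic_tuple:
  assumes F: "generic_tuple F" and y: "y ` {..<n} \<subseteq> range F"
    and P: "P \<in> polys_in n" "poly_val P (\<lambda>_. 0) = 0"
  shows "poly_fun P y = (\<lambda>_. 0) \<or> hypercyclic entire_topology deriv (poly_fun P y)"
    and "inj_on y {..<n} \<Longrightarrow> P \<noteq> 0 \<Longrightarrow> hypercyclic entire_topology deriv (poly_fun P y)"
proof -
  have "\<exists>j. y i = F j" if "i < n" for i using y that by blast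
  then obtain \<sigma> where \<sigma>: "\<And>i. i < n \<Longrightarrow> y i = F (\<sigma> i)" by metis
  obtain w where w: "\<And>\<mu>. set (w \<mu>) \<subseteq> Poly_Mapping.keys \<mu>"
      "\<And>\<mu> x. monomial_val \<mu> x = (\<Prod>i\<leftarrow>w \<mu>. x i)"
    using monomial_as_word by metis
  have lt: "i < n" if "\<mu> \<in> Poly_Mapping.keys P" "i \<in> set (w \<mu>)" for \<mu> i
    using that w(1)[of \<mu>] P(1) by (auto simp: polys_in_def)
  have ne: "map \<sigma> (w \<mu>) \<noteq> []" if \<mu>: "\<mu> \<in> Poly_Mapping.keys P" for \<mu>
  proof
    assume "map \<sigma> (w \<mu>) = []"
    then have "monomial_val \<mu> (\<lambda>_. 0) = 1" using w(2)[where \<mu> = \<mu> and x = "\<lambda>_. 0"] by simp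
    have "\<mu> \<noteq> 0" using \<mu> P(2) poly_val_zero[of P] by (auto simp: in_keys_iff)
    then show False using monomial_val_zero[of \<mu>] \<open>monomial_val \<mu> (\<lambda>_. 0) = 1\<close> by simp
  qed
  have val: "poly_val P x' = (\<Sum>\<mu>\<in>Poly_Mapping.keys P. Poly_Mapping.lookup P \<mu> * (\<Prod>i\<leftarrow>map \<sigma> (w \<mu>). x i))"
    if "\<And>i. i < n \<Longrightarrow> x' i = x (\<sigma> i)" for x x'
    unfolding poly_val_def w(2)
  proof (intro sum.cong refl arg_cong2[where f = "(*)"])
    fix \<mu> assume "\<mu> \<in> Poly_Mapping.keys P"
    then have "map x' (w \<mu>) = map (\<lambda>i. x (\<sigma> i)) (w \<mu>)"
      by (intro map_cong refl) (use lt that in blast)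
    then show "(\<Prod>i\<leftarrow>w \<mu>. x' i) = (\<Prod>i\<leftarrow>map \<sigma> (w \<mu>). x i)" by (simp only: map_map comp_def)
  qed
  have fun_eq: "poly_fun P y =
      (\<lambda>z. \<Sum>\<mu>\<in>Poly_Mapping.keys P. Poly_Mapping.lookup P \<mu> * (\<Prod>i\<leftarrow>map \<sigma> (w \<mu>). F i z))"
    unfolding poly_fun_def using \<sigma> by (intro ext val) simp
  have hc: "hypercyclic entire_topology deriv (poly_fun P y)"
    if "(\<Sum>\<mu>\<in>Poly_Mapping.keys P. Poly_Mapping.lookup P \<mu> * (\<Prod>i\<leftarrow>map \<sigma> (w \<mu>). x i)) \<noteq> 0" for x
    unfolding fun_eq using hypercyclic_word_combination[OF F finite_keys ne that] .
  show "poly_fun P y = (\<lambda>_. 0) \<or> hypercyclic entire_topology deriv (poly_fun P y)"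
    using hc unfolding fun_eq by blast
  show "hypercyclic entire_topology deriv (poly_fun P y)" if inj: "inj_on y {..<n}" and "P \<noteq> 0"
  proof -
    obtain x' where x': "poly_val P x' \<noteq> 0" using poly_val_nonzero[OF \<open>P \<noteq> 0\<close>] by blast
    have "inj_on \<sigma> {..<n}" using inj \<sigma> by (auto simp: inj_on_def)
    then have "x' i = (x' \<circ> the_inv_into {..<n} \<sigma>) (\<sigma> i)" if "i < n" for i
      using that by (simp add: the_inv_into_f_f)
    from val[of x', OF this] x' show ?thesis using hc by metis
  qed
qed

theorem corollary1p3:
  shows "densely_strongly_algebrable entire_topology {f. hypercyclic entire_topology deriv f}"
proof -
  obtain F where F: "generic_tuple F" using ex_generic_tuple by blast
  have hol: "F i holomorphic_on UNIV" for i using F by (simp add: generic_tuple_def)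
  \<comment> \<open>Equal entries would make the difference of two variables, a nonzero polynomial, vanish at \<open>F\<close>.\<close>
  have "inj F"
  proof (rule injI, rule ccontr)
    fix i j assume eq: "F i = F j" and "i \<noteq> j"
    define x :: "nat \<Rightarrow> complex" where "x l = (if l = i then 1 else 0)" for l
    have "hypercyclic entire_topology deriv
        (\<lambda>z. \<Sum>a\<in>{i, j}. (if a = i then 1 else - 1) * (\<Prod>l\<leftarrow>[a]. F l z))"
      by (rule hypercyclic_word_combination[OF F, where x = x])
        (use \<open>i \<noteq> j\<close> in \<open>auto simp: x_def\<close>)
    then show False using \<open>i \<noteq> j\<close> eq not_hypercyclic_zero by simp
  qed
  then have inf: "infinite (range F)" by (simp add: finite_image_iff)
  have alg: "algebraically_independent (range F)"
    unfolding algebraically_independent_def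
    using poly_fun_generic_tuple(2)[OF F] not_hypercyclic_zero by metis
  have sub: "generated_subalgebra (range F) \<subseteq> {f. hypercyclic entire_topology deriv f} \<union> {\<lambda>_. 0}"
    unfolding generated_subalgebra_def using poly_fun_generic_tuple(1)[OF F] by blast
  have mem: "F i \<in> generated_subalgebra (range F)" for i
  proof -
    let ?P = "Poly_Mapping.single (Poly_Mapping.single (0 :: nat) (1 :: nat)) (1 :: complex)"
    have "F i = poly_fun ?P (\<lambda>_. F i)" "?P \<in> polys_in 1" "poly_val ?P (\<lambda>_. 0) = 0"
      by (auto simp: poly_fun_def poly_val_def polys_in_def)
    then show ?thesis unfolding generated_subalgebra_def by blast
  qed
  have dense: "dense_in entire_topology (generated_subalgebra (range F))"
  proof (rule dense_in_entire_topologyI)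
    show "f holomorphic_on UNIV" if "f \<in> generated_subalgebra (range F)" for f
      using sub that by (auto simp: hypercyclic_def topspace_entire_topology)
    fix h r and e :: real assume h: "h holomorphic_on UNIV" and e: "0 < e"
    obtain q where q: "q \<in> rat_polys" "\<And>z. z \<in> cball 0 r \<Longrightarrow> norm (poly q z - h z) < e / 2"
      using rat_polys_dense[OF h, of "e / 2" r] e by auto
    obtain k1 where k1: "r \<le> real k1" using real_arch_simple by blast
    obtain k2 where k2: "inverse (real (Suc k2)) < e / 2" using reals_Archimedean[of "e / 2"] e by auto
    define k where "k = max k1 k2"
    have k: "r \<le> real k" using k1 by (simp add: k_def)
    have "1 / real (Suc k) \<le> inverse (real (Suc k2))"
      by (simp add: k_def inverse_eq_divide frac_le)
    have "F \<in> entry_hits q k" using F q(1) by (simp add: generic_tuple_def)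
    then obtain i e' where e': "e' < 1 / Suc k" and i: "\<And>z. z \<in> cball 0 (real k) \<Longrightarrow> norm (F i z - poly q z) \<le> e'"
      unfolding entry_hits_def by blast
    have "norm (F i z - h z) < e" if z: "z \<in> cball 0 r" for z
    proof -
      have "norm (F i z - poly q z) \<le> e'" using i z k by simp
      then have "norm (F i z - poly q z) < e / 2"
        using e' k2 \<open>1 / real (Suc k) \<le> inverse (real (Suc k2))\<close> by linarith
      then show ?thesis
        using q(2)[OF z] norm_triangle_ineq[of "F i z - poly q z" "poly q z - h z"] by simp
    qed
    then show "\<exists>f\<in>generated_subalgebra (range F). \<forall>z\<in>cball 0 r. norm (f z - h z) < e"
      using mem by blast
  qed
  have "range F \<subseteq> topspace entire_topology" using hol by (auto simp: topspace_entire_topology)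
  then show ?thesis unfolding densely_strongly_algebrable_def using inf alg dense sub by blast
qed

end
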